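(* Let $N\ge1$ be an integer, $q=e^{2\pi i/N}$, and let $\alpha>-1$ be a real number. Let $R_kf(z)=f(q^k/z)$, $T_kf(z)=f(q^kz)$, let $\mathcal I$ be the identity, and put $$B_k(z)=\frac{2(2\alpha+1)q^kz^2}{(q^k-z^2)^2},\qquad C(z)=z\left[1+N(2\alpha+1)+\frac{2N(2\alpha+1)}{z^{2N}-1}\right].$$ Then the sieved ultraspherical polynomials of the first kind $P_n(x;N)$ satisfy the eigenvalue equation $$H(N)P_n(z+1/z;N)=n\bigl(n+(2\alpha+1)N\bigr)P_n(z+1/z;N),\qquad n=0,1,2,\dots,$$ where the operator $H(N)$ has equivalently (on symmetric Laurent polynomials, $f(z)=f(1/z)$) either one of the following two expressions: $$H(N)=z^2\partial_z^2+C(z)\partial_z+\sum_{k=0}^{N-1}B_k(z)(R_k-\mathcal I),$$ $$H(N)=z^2\partial_z^2+C(z)\partial_z+\sum_{k=1}^{N-1}B_k(z)(T_{-k}-\mathcal I).$$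
   Context: The sieved ultraspherical polynomials of the first kind are the sieved Jacobi polynomials of the first kind with $\beta=\alpha$, defined as follows. Let $a_n=-\dfrac{(\alpha+1/2)(1+(-1)^{n+1})}{n+2\alpha+2}$, $n=0,1,2,\dots$, and let $a_n(N)=a_{k-1}$ if $n=Nk-1$ for some integer $k\ge1$, and $a_n(N)=0$ otherwise. Define $\Phi_0(z;N)=1$, $\Phi_{n+1}(z;N)=z\Phi_n(z;N)-a_n(N)\,z^n\Phi_n(1/z;N)$. Then $P_n(x;N)$ is the monic polynomial of degree $n$ in $x$ determined by $P_0=1$ and $$P_n(z+z^{-1};N)=z^{1-n}\Phi_{2n-1}(z;N)+z^{n-1}\Phi_{2n-1}(1/z;N)\quad(n\ge1).$$ The operator $H(N)$ is $H(N)=L(N)^2-N(2\alpha+1)L(N)$ with $L(N)=z\partial_z+\sum_{k=0}^{N-1}\dfrac{(2\alpha+1)z^2}{q^k-z^2}(R_k-\mathcal I)$. *)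

theory Defs
  imports "HOL-Analysis.Analysis" "HOL-Computational_Algebra.Polynomial"
begin

definition jacobi_param :: "real \<Rightarrow> nat \<Rightarrow> real" where
  "jacobi_param \<alpha> n = - ((\<alpha> + 1/2) * (1 + (-1) ^ (n + 1))) / (real n + 2 * \<alpha> + 2)"

text \<open>If \<open>n = N k - 1\<close> with \<open>k \<ge> 1\<close>, then \<open>k = (n + 1) div N\<close>.\<close>

definition sieved_param :: "nat \<Rightarrow> real \<Rightarrow> nat \<Rightarrow> real" where
  "sieved_param N \<alpha> n =
     (if N dvd n + 1 then jacobi_param \<alpha> ((n + 1) div N - 1) else 0)"

text \<open>As \<open>\<Phi>\<^sub>n\<close> has degree exactly \<open>n\<close>, \<open>reflect_poly\<close> yields the polynomial
  \<open>z\<^sup>n \<Phi>\<^sub>n(1/z)\<close>; see \<open>poly_sieved_Phi_Suc\<close> below.\<close>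

primrec sieved_Phi :: "nat \<Rightarrow> real \<Rightarrow> nat \<Rightarrow> complex poly" where
  "sieved_Phi N \<alpha> 0 = 1"
| "sieved_Phi N \<alpha> (Suc n) =
     pCons 0 (sieved_Phi N \<alpha> n)
       - smult (of_real (sieved_param N \<alpha> n)) (reflect_poly (sieved_Phi N \<alpha> n))"

lemma sieved_Phi_monic:
  "degree (sieved_Phi N \<alpha> n) = n \<and> coeff (sieved_Phi N \<alpha> n) n = 1"
proof (induction n)
  case 0
  then show ?case by simp
next
  case (Suc n)
  let ?p = "sieved_Phi N \<alpha> n"
  let ?r = "smult (of_real (sieved_param N \<alpha> n)) (reflect_poly ?p)"
  have r: "degree ?r \<le> n"
    using Suc degree_reflect_poly_le[of ?p] degree_smult_le order_trans by metis
  have c: "coeff (sieved_Phi N \<alpha> (Suc n)) (Suc n) = 1"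
    using Suc coeff_eq_0[of ?r "Suc n"] r by simp
  have "degree (sieved_Phi N \<alpha> (Suc n)) \<le> Suc n"
    using Suc r by (auto intro!: degree_diff_le order_trans[OF degree_pCons_le])
  with c show ?case
    by (metis le_antisym le_degree zero_neq_one)
qed

lemma poly_sieved_Phi_Suc:
  assumes "z \<noteq> 0"
  shows "poly (sieved_Phi N \<alpha> (Suc n)) z =
           z * poly (sieved_Phi N \<alpha> n) z
             - of_real (sieved_param N \<alpha> n) * z ^ n * poly (sieved_Phi N \<alpha> n) (1 / z)"
  using assms sieved_Phi_monic[of N \<alpha> n]
  by (simp add: poly_reflect_poly_nz inverse_eq_divide)

definition is_sieved_ultraspherical :: "nat \<Rightarrow> real \<Rightarrow> nat \<Rightarrow> complex poly \<Rightarrow> bool" where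
  "is_sieved_ultraspherical N \<alpha> n p \<longleftrightarrow>
     degree p = n \<and> lead_coeff p = 1 \<and>
     (n \<ge> 1 \<longrightarrow> (\<forall>z. z \<noteq> 0 \<longrightarrow>
        poly p (z + 1 / z) =
          z powi (1 - int n) * poly (sieved_Phi N \<alpha> (2 * n - 1)) z
            + z powi (int n - 1) * poly (sieved_Phi N \<alpha> (2 * n - 1)) (1 / z)))"

definition sieved_ultraspherical :: "nat \<Rightarrow> real \<Rightarrow> nat \<Rightarrow> complex poly" where
  "sieved_ultraspherical N \<alpha> n = (THE p. is_sieved_ultraspherical N \<alpha> n p)"

text \<open>The description above is well posed: such a polynomial exists and is unique.
  Existence uses the polynomials \<open>D\<^sub>k\<close> with \<open>D\<^sub>k(z + 1/z) = z\<^sup>k + z\<^sup>-\<^sup>k\<close>.\<close>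

fun dickson_poly :: "nat \<Rightarrow> complex poly" where
  "dickson_poly 0 = [:2:]"
| "dickson_poly (Suc 0) = [:0, 1:]"
| "dickson_poly (Suc (Suc k)) = pCons 0 (dickson_poly (Suc k)) - dickson_poly k"

lemma poly_dickson_poly:
  "z \<noteq> 0 \<Longrightarrow> poly (dickson_poly k) (z + 1 / z) = z ^ k + (1 / z) ^ k"
  by (induction k rule: dickson_poly.induct) (auto simp: field_simps)

lemma dickson_poly_monic:
  "degree (dickson_poly k) = k \<and> (k \<ge> 1 \<longrightarrow> coeff (dickson_poly k) k = 1)"
proof (induction k rule: dickson_poly.induct)
  case (3 k)
  let ?p = "dickson_poly (Suc (Suc k))"
  have c: "coeff ?p (Suc (Suc k)) = 1"
    using 3 coeff_eq_0[of "dickson_poly k" "Suc (Suc k)"] by simp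
  have "degree ?p \<le> Suc (Suc k)"
    using 3 by (auto intro!: degree_diff_le order_trans[OF degree_pCons_le])
  with c show ?case
    by (metis le_antisym le_degree zero_neq_one)
qed auto

lemma ex_sieved_ultraspherical: "\<exists>p. is_sieved_ultraspherical N \<alpha> n p"
proof (cases n)
  case 0
  then show ?thesis
    by (intro exI[of _ 1]) (simp add: is_sieved_ultraspherical_def)
next
  case (Suc m)
  let ?F = "sieved_Phi N \<alpha> (Suc (2 * m))"
  define q where "q = (\<Sum>i\<le>2 * m. smult (coeff ?F i) (dickson_poly (nat \<bar>int i - int m\<bar>)))"
  define p where "p = dickson_poly n + q"
  have F: "degree ?F = Suc (2 * m)" "coeff ?F (Suc (2 * m)) = 1"
    using sieved_Phi_monic[of N \<alpha> "Suc (2 * m)"] by blast+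
  have dq: "degree q \<le> m"
    unfolding q_def
  proof (rule degree_sum_le)
    fix i assume "i \<in> {..2 * m}"
    then have "nat \<bar>int i - int m\<bar> \<le> m" by auto
    then show "degree (smult (coeff ?F i) (dickson_poly (nat \<bar>int i - int m\<bar>))) \<le> m"
      using dickson_poly_monic degree_smult_le order_trans by metis
  qed simp
  have c: "coeff p n = 1"
    using dickson_poly_monic[of n] coeff_eq_0[of q n] dq Suc by (simp add: p_def)
  have "degree p \<le> n"
    unfolding p_def using dickson_poly_monic[of n] dq Suc by (auto intro!: degree_add_le)
  with c have dp: "degree p = n"
    by (metis le_antisym le_degree zero_neq_one)
  have "poly p (z + 1 / z) =
          z powi (1 - int n) * poly ?F z + z powi (int n - 1) * poly ?F (1 / z)"
    if z: "z \<noteq> 0" for z :: complex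
  proof -
    have D: "poly (dickson_poly (nat \<bar>j\<bar>)) (z + 1 / z) = z powi j + z powi (- j)" for j :: int
      using z poly_dickson_poly[OF z, of "nat \<bar>j\<bar>"]
      by (cases "j \<ge> 0") (auto simp: power_int_def power_one_over inverse_eq_divide)
    have e1: "z powi (- int m) * z ^ i = z powi (int i - int m)" for i
      using z by (simp add: power_int_diff power_int_minus field_simps)
    have e2: "z powi (int m) * (1 / z) ^ i = z powi (- (int i - int m))" for i
      using z by (simp add: power_int_diff power_int_minus power_one_over field_simps)
    have "poly p (z + 1 / z) =
            (\<Sum>i\<le>Suc (2 * m). coeff ?F i * (z powi (int i - int m) + z powi (- (int i - int m))))"
    proof -
      have "poly (dickson_poly n) (z + 1 / z) = z powi (int (Suc (2 * m)) - int m)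
              + z powi (- (int (Suc (2 * m)) - int m))"
        using D[of "int n", unfolded abs_of_nat nat_int] Suc by (simp add: algebra_simps del: dickson_poly.simps)
      then show ?thesis
        using F(2)
        by (simp add: p_def q_def poly_sum D del: sieved_Phi.simps dickson_poly.simps)
    qed
    also have "\<dots> = (\<Sum>i\<le>Suc (2 * m). coeff ?F i * (z powi (- int m) * z ^ i + z powi (int m) * (1 / z) ^ i))"
      by (simp only: e1 e2)
    also have "\<dots> = z powi (- int m) * poly ?F z + z powi (int m) * poly ?F (1 / z)"
      by (simp only: poly_altdef F(1) sum_distrib_left sum.distrib[symmetric]) (simp only: algebra_simps)
    finally show ?thesis using Suc by simp
  qed
  with c dp Suc show ?thesis
    by (intro exI[of _ p]) (simp add: is_sieved_ultraspherical_def)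
qed

lemma is_sieved_ultraspherical_unique:
  assumes "is_sieved_ultraspherical N \<alpha> n p" "is_sieved_ultraspherical N \<alpha> n p'"
  shows "p = p'"
proof (cases "n = 0")
  case True
  with assms show ?thesis
    by (auto simp: is_sieved_ultraspherical_def elim!: degree_eq_zeroE)
next
  case False
  have "poly p x = poly p' x" for x
  proof -
    obtain z :: complex where z: "z\<^sup>2 - x * z + 1 = 0"
    proof -
      define w where "w = csqrt (x\<^sup>2 - 4)"
      have "((x + w) / 2)\<^sup>2 - x * ((x + w) / 2) + 1 = (w\<^sup>2 - (x\<^sup>2 - 4)) / 4"
        by (simp add: field_simps power2_eq_square)
      also have "\<dots> = 0" by (simp add: w_def)
      finally have "((x + w) / 2)\<^sup>2 - x * ((x + w) / 2) + 1 = 0" .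
      then show thesis using that by blast
    qed
    then have "z \<noteq> 0" by auto
    moreover from this z have "x = z + 1 / z"
      by (simp add: field_simps power2_eq_square)
    ultimately show ?thesis
      using assms False by (simp add: is_sieved_ultraspherical_def)
  qed
  then show ?thesis by (simp add: poly_eq_poly_eq_iff[symmetric] fun_eq_iff)
qed

lemma is_sieved_ultraspherical_sieved_ultraspherical:
  "is_sieved_ultraspherical N \<alpha> n (sieved_ultraspherical N \<alpha> n)"
  unfolding sieved_ultraspherical_def
  using ex_sieved_ultraspherical is_sieved_ultraspherical_unique
  by (metis (mono_tags, lifting) theI')

text \<open>The operators act on functions on the punctured plane; values at \<open>0\<close> are irrelevant.
  Their coefficients have poles only at \<open>0\<close> and where \<open>z\<^bsup>2N\<^esup> = 1\<close>, so that operator identities are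
  meant on the open set \<open>generic_points N\<close>, which \<open>z \<mapsto> q\<^sup>k/z\<close> and \<open>z \<mapsto> q\<^sup>k z\<close> preserve;
  in particular a composition such as \<open>L\<^sup>2\<close> is never affected by division by zero there.\<close>

definition generic_points :: "nat \<Rightarrow> complex set" where
  "generic_points N = {z. z \<noteq> 0 \<and> z ^ (2 * N) \<noteq> 1}"

definition q_root :: "nat \<Rightarrow> complex" where
  "q_root N = exp (2 * of_real pi * \<i> / of_nat N)"

definition R_op :: "nat \<Rightarrow> nat \<Rightarrow> (complex \<Rightarrow> complex) \<Rightarrow> complex \<Rightarrow> complex" where
  "R_op N k f = (\<lambda>z. f (q_root N ^ k / z))"

definition T_op :: "nat \<Rightarrow> int \<Rightarrow> (complex \<Rightarrow> complex) \<Rightarrow> complex \<Rightarrow> complex" where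
  "T_op N k f = (\<lambda>z. f (q_root N powi k * z))"

definition L_op :: "nat \<Rightarrow> real \<Rightarrow> (complex \<Rightarrow> complex) \<Rightarrow> complex \<Rightarrow> complex" where
  "L_op N \<alpha> f = (\<lambda>z. z * deriv f z
     + (\<Sum>k<N. of_real (2 * \<alpha> + 1) * z\<^sup>2 / (q_root N ^ k - z\<^sup>2) * (R_op N k f z - f z)))"

definition H_op :: "nat \<Rightarrow> real \<Rightarrow> (complex \<Rightarrow> complex) \<Rightarrow> complex \<Rightarrow> complex" where
  "H_op N \<alpha> f = (\<lambda>z. L_op N \<alpha> (L_op N \<alpha> f) z
     - of_nat N * of_real (2 * \<alpha> + 1) * L_op N \<alpha> f z)"

definition B_coeff :: "nat \<Rightarrow> real \<Rightarrow> nat \<Rightarrow> complex \<Rightarrow> complex" where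
  "B_coeff N \<alpha> k z =
     2 * of_real (2 * \<alpha> + 1) * q_root N ^ k * z\<^sup>2 / (q_root N ^ k - z\<^sup>2)\<^sup>2"

definition C_coeff :: "nat \<Rightarrow> real \<Rightarrow> complex \<Rightarrow> complex" where
  "C_coeff N \<alpha> z = z * (1 + of_nat N * of_real (2 * \<alpha> + 1)
     + 2 * of_nat N * of_real (2 * \<alpha> + 1) / (z ^ (2 * N) - 1))"

definition laurent_polynomial :: "(complex \<Rightarrow> complex) \<Rightarrow> bool" where
  "laurent_polynomial f \<longleftrightarrow> (\<exists>p m. \<forall>z. z \<noteq> 0 \<longrightarrow> f z = poly p z / z ^ m)"

definition symmetric_laurent_polynomial :: "(complex \<Rightarrow> complex) \<Rightarrow> bool" where
  "symmetric_laurent_polynomial f \<longleftrightarrow>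
     laurent_polynomial f \<and> (\<forall>z. z \<noteq> 0 \<longrightarrow> f z = f (1 / z))"

end

theory Submission
  imports Defs "HOL-Complex_Analysis.Cauchy_Integral_Formula"
begin

text \<open>
  Write \<open>c = 2\<alpha> + 1\<close> and let \<open>\<zeta>\<close> run over the \<open>N\<close>-th roots of unity, so that
  \<open>L f(z) = z f'(z) + \<Sum>\<^sub>\<zeta> A\<^sub>\<zeta>(z) (f(\<zeta>/z) - f(z))\<close> with \<open>A\<^sub>\<zeta>(z) = c z\<^sup>2 / (\<zeta> - z\<^sup>2)\<close>.
  Summing over the group of roots instead of over exponents turns every reduction modulo \<open>N\<close> of
  an index into a translation of the group.

  \<^emph>\<open>Eigenvalue equation.\<close> The recurrence coefficients \<open>a\<^sub>n(N)\<close> vanish unless \<open>2N\<close> divides \<open>n + 1\<close>.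
  Therefore \<open>\<Phi>\<^sub>m\<close> is only multiplied by \<open>z\<close> between consecutive multiples of \<open>2N\<close>, and
  \<open>\<Phi>\<^bsub>2Nj\<^esub>(z) = u\<^sup>j g\<^sub>j(u)\<close> with \<open>u = z\<^sup>N\<close>, where \<open>g\<^sub>j\<close> is the Laurent polynomial
  \<open>circle_gegenbauer c j\<close>, which does not depend on \<open>N\<close>. For \<open>n = jN + s\<close> with \<open>1 \<le> s \<le> N\<close> this says
  \<open>P\<^sub>n(z + 1/z) = E(z) + E(1/z)\<close> with \<open>E(z) = z\<^sup>s g\<^sub>j(z\<^sup>N)\<close>. The two halves are easier than their
  sum because they are (almost) eigenfunctions of the first-order operator \<open>L\<close>: the partial fraction
  expansion of \<open>w\<^bsup>s-1\<^esup> / (1 - w\<^sup>N)\<close> reduces the action of \<open>L\<close> on \<open>E\<close> to a first-order relation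
  between \<open>g\<^sub>j(u)\<close> and \<open>g\<^sub>j(1/u)\<close>, proved by induction on \<open>j\<close>, and gives \<open>L E = (n + Nc) E\<close>.
  The reflection \<open>z \<mapsto> 1/z\<close> exchanges the two roots \<open>n + Nc\<close> and \<open>-n\<close> of
  \<open>\<lambda>\<^sup>2 - Nc \<lambda> = n (n + Nc)\<close>, up to a triangular correction for \<open>s = N\<close>, so that \<open>H = L\<^sup>2 - Nc L\<close> acts
  on both halves, hence on \<open>P\<^sub>n\<close>, as \<open>n (n + Nc)\<close>.

  \<^emph>\<open>Second-order form.\<close> When \<open>L\<^sup>2\<close> is expanded, the derivatives \<open>f'(\<zeta>/z)\<close> cancel and
  \<open>z \<partial>\<^sub>z A\<^sub>\<zeta>\<close> is the coefficient \<open>B\<close> of \<open>R\<^sub>k - I\<close>. What remains is a double sum of reflections. On a symmetric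
  \<open>f\<close> a composition of two reflections is again a reflection, so it can be collected into a single
  sum over the group (\<open>sum_dunkl_coeff_commutator\<close>). Its quadratic coefficients telescope to zero
  (\<open>sum_dunkl_coeff_product\<close>), and the linear ones are cancelled by \<open>-Nc L\<close>. The form with \<open>T\<^sub>-\<^sub>k\<close>
  is the same formula, because \<open>R\<^sub>k f = T\<^sub>-\<^sub>k f\<close> for symmetric \<open>f\<close>.
\<close>

section \<open>Sums over roots of unity\<close>

definition unity_roots :: "nat \<Rightarrow> complex set" where
  "unity_roots N = {\<zeta>. \<zeta> ^ N = 1}"

lemma card_unity_roots: "N \<ge> 1 \<Longrightarrow> card (unity_roots N) = N"
  unfolding unity_roots_def using card_roots_unity_eq by auto

lemma unity_roots_nonzero: "N \<ge> 1 \<Longrightarrow> \<zeta> \<in> unity_roots N \<Longrightarrow> \<zeta> \<noteq> 0"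
  by (auto simp: unity_roots_def power_0_left)

lemma unity_roots_mult:
  "\<zeta> \<in> unity_roots N \<Longrightarrow> \<eta> \<in> unity_roots N \<Longrightarrow> \<zeta> * \<eta> \<in> unity_roots N"
  by (simp add: unity_roots_def power_mult_distrib)

lemma unity_roots_divide:
  "\<zeta> \<in> unity_roots N \<Longrightarrow> \<eta> \<in> unity_roots N \<Longrightarrow> \<zeta> / \<eta> \<in> unity_roots N"
  by (simp add: unity_roots_def power_divide)

lemma one_in_unity_roots: "1 \<in> unity_roots N"
  by (simp add: unity_roots_def)

lemma q_root_power: "q_root N ^ k = cis (2 * pi * real k / real N)"
  by (simp add: q_root_def exp_of_nat_mult [symmetric] cis_conv_exp mult_ac)

lemma bij_betw_q_root:
  assumes "N \<ge> 1"
  shows "bij_betw (\<lambda>k. q_root N ^ k) {..<N} (unity_roots N)"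
  using Complex.bij_betw_roots_unity[of N] assms by (simp add: q_root_power unity_roots_def)

lemma sum_q_root:
  fixes F :: "complex \<Rightarrow> complex"
  assumes "N \<ge> 1"
  shows "(\<Sum>k<N. F (q_root N ^ k)) = (\<Sum>\<zeta>\<in>unity_roots N. F \<zeta>)"
  using sum.reindex_bij_betw[OF bij_betw_q_root[OF assms]] .

text \<open>Multiplication by the generator \<open>q\<close> permutes the roots and multiplies the sum by \<open>q\<^sup>m\<close>,
  which differs from \<open>1\<close> unless \<open>N\<close> divides \<open>m\<close>.\<close>

lemma sum_unity_roots_power:
  assumes "N \<ge> 1"
  shows "(\<Sum>\<zeta>\<in>unity_roots N. \<zeta> ^ m) = (if N dvd m then of_nat N else 0)"
proof (cases "N dvd m")
  case True
  then have "\<zeta> ^ m = 1" if "\<zeta> \<in> unity_roots N" for \<zeta>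
    using that by (auto simp: unity_roots_def power_mult elim!: dvdE)
  then show ?thesis using True card_unity_roots[OF assms] by simp
next
  case False
  let ?q = "q_root N" and ?S = "\<Sum>\<zeta>\<in>unity_roots N. \<zeta> ^ m"
  have bij: "bij_betw (\<lambda>k. ?q ^ k) {..<N} (unity_roots N)"
    by (rule bij_betw_q_root[OF assms])
  have q: "?q \<in> unity_roots N"
    using q_root_power[of N N] assms by (simp add: unity_roots_def)
  then have qN: "?q ^ N = 1" by (simp add: unity_roots_def)
  have "?q ^ m = ?q ^ (m mod N)"
  proof -
    have "?q ^ (N * (m div N) + m mod N) = ?q ^ (m mod N)"
      by (simp only: power_add power_mult qN power_one mult_1)
    then show ?thesis by simp
  qed
  moreover have "?q ^ (m mod N) \<noteq> ?q ^ 0"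
    using inj_onD[OF bij_betw_imp_inj_on[OF bij], of "m mod N" 0] False assms
    by (auto simp: mod_eq_0_iff_dvd)
  ultimately have ne: "?q ^ m \<noteq> 1" by simp
  have "?S = (\<Sum>\<zeta>\<in>unity_roots N. (?q * \<zeta>) ^ m)"
    using q unity_roots_nonzero[OF assms q]
    by (intro sum.reindex_bij_witness[where i = "\<lambda>\<zeta>. ?q * \<zeta>" and j = "\<lambda>\<zeta>. \<zeta> / ?q"])
       (auto intro: unity_roots_mult unity_roots_divide)
  also have "\<dots> = ?q ^ m * ?S"
    by (simp add: power_mult_distrib sum_distrib_left)
  finally have "(1 - ?q ^ m) * ?S = 0" by (simp add: left_diff_distrib)
  then have "?S = 0" using ne by simp
  then show ?thesis using False by simp
qed

text \<open>Expanding \<open>(1 - w\<^sup>N) / (\<zeta> - w) = (\<zeta>\<^sup>N - w\<^sup>N) / (\<zeta> - w)\<close> as a geometric sum,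
  orthogonality of the characters \<open>\<zeta> \<mapsto> \<zeta>\<^sup>m\<close> leaves only the term \<open>w\<^bsup>s-1\<^esup>\<close>. The range
  \<open>1 \<le> s \<le> N\<close> is the one in which no exponent wraps around.\<close>

lemma sum_unity_roots_partial_fraction:
  assumes N: "N \<ge> 1" and s: "1 \<le> s" "s \<le> N" and w: "w ^ N \<noteq> 1"
  shows "(\<Sum>\<zeta>\<in>unity_roots N. \<zeta> ^ s / (\<zeta> - w)) = of_nat N * w ^ (s - 1) / (1 - w ^ N)"
proof -
  have "(1 - w ^ N) * (\<zeta> ^ s / (\<zeta> - w)) = (\<Sum>i<N. w ^ i * \<zeta> ^ (N - Suc i + s))"
    if z: "\<zeta> \<in> unity_roots N" for \<zeta>
  proof -
    have "\<zeta> ^ N = 1" using z by (simp add: unity_roots_def)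
    then have ne: "\<zeta> - w \<noteq> 0" using w by auto
    define Q where "Q = (\<Sum>i<N. \<zeta> ^ (N - Suc i) * w ^ i)"
    have "1 - w ^ N = (\<zeta> - w) * Q"
      using power_diff_sumr2[of w N \<zeta>] \<open>\<zeta> ^ N = 1\<close> by (simp add: Q_def algebra_simps)
    moreover have "(\<Sum>i<N. w ^ i * \<zeta> ^ (N - Suc i + s)) = Q * \<zeta> ^ s"
      unfolding Q_def sum_distrib_right by (intro sum.cong refl) (simp only: power_add mult_ac)
    ultimately show ?thesis using ne by (simp only:) simp
  qed
  then have "(1 - w ^ N) * (\<Sum>\<zeta>\<in>unity_roots N. \<zeta> ^ s / (\<zeta> - w))
      = (\<Sum>\<zeta>\<in>unity_roots N. \<Sum>i<N. w ^ i * \<zeta> ^ (N - Suc i + s))"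
    by (simp add: sum_distrib_left)
  also have "\<dots> = (\<Sum>i<N. w ^ i * (\<Sum>\<zeta>\<in>unity_roots N. \<zeta> ^ (N - Suc i + s)))"
    by (subst sum.swap) (simp add: sum_distrib_left)
  also have "\<dots> = (\<Sum>i<N. if i = s - 1 then of_nat N * w ^ (s - 1) else 0)"
  proof (rule sum.cong)
    fix i assume i: "i \<in> {..<N}"
    have "N dvd N - Suc i + s \<longleftrightarrow> i = s - 1"
    proof
      assume "N dvd N - Suc i + s"
      then obtain d where d: "N - Suc i + s = N * d" by (elim dvdE)
      have b: "N - Suc i + s > 0" "N - Suc i + s < N * 2" using i s by auto
      then have "d = 1" using d by (cases d; cases "d - 1") auto
      then show "i = s - 1" using d i s by auto
    qed (use i s in auto)
    then show "w ^ i * (\<Sum>\<zeta>\<in>unity_roots N. \<zeta> ^ (N - Suc i + s))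
        = (if i = s - 1 then of_nat N * w ^ (s - 1) else 0)"
      by (simp add: sum_unity_roots_power[OF N])
  qed simp
  also have "\<dots> = of_nat N * w ^ (s - 1)" using s by simp
  finally show ?thesis using w by (simp add: field_simps)
qed

section \<open>The first-order operator\<close>

definition dunkl_coeff :: "complex \<Rightarrow> complex \<Rightarrow> complex \<Rightarrow> complex" where
  "dunkl_coeff c \<zeta> z = c * z\<^sup>2 / (\<zeta> - z\<^sup>2)"

lemma open_generic_points: "open (generic_points N)"
proof -
  have "generic_points N = - {0} \<inter> (\<lambda>z. z ^ (2 * N)) -` (- {1})"
    by (auto simp: generic_points_def)
  then show ?thesis
    by (auto intro!: open_Int open_vimage continuous_intros)
qed

lemma generic_points_nonzero: "z \<in> generic_points N \<Longrightarrow> z \<noteq> 0"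
  by (simp add: generic_points_def)

lemma generic_points_square_neq:
  "z \<in> generic_points N \<Longrightarrow> \<zeta> \<in> unity_roots N \<Longrightarrow> \<zeta> \<noteq> z\<^sup>2"
  by (auto simp: generic_points_def unity_roots_def power_mult)

lemma generic_points_divide:
  "z \<in> generic_points N \<Longrightarrow> \<zeta> \<in> unity_roots N \<Longrightarrow> N \<ge> 1 \<Longrightarrow> \<zeta> / z \<in> generic_points N"
  using unity_roots_nonzero[of N \<zeta>]
  by (auto simp: generic_points_def power_divide unity_roots_def power_mult power_mult[of \<zeta> N 2]
        mult.commute[of 2 N])

lemma sum_unity_roots_Cauchy:
  assumes N: "N \<ge> 1" and z: "z \<in> generic_points N"
  shows "z\<^sup>2 * (\<Sum>\<zeta>\<in>unity_roots N. 1 / (\<zeta> - z\<^sup>2)) = z ^ (2 * N) * of_nat N / (1 - z ^ (2 * N))"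
proof -
  have w: "(z\<^sup>2) ^ N = z ^ (2 * N)" by (simp add: power_mult)
  have "z\<^sup>2 * (z\<^sup>2) ^ (N - 1) = z ^ (2 * N)"
    using N unfolding w[symmetric] power_Suc[symmetric] by simp
  moreover have "(\<Sum>\<zeta>\<in>unity_roots N. 1 / (\<zeta> - z\<^sup>2)) = (\<Sum>\<zeta>\<in>unity_roots N. \<zeta> ^ N / (\<zeta> - z\<^sup>2))"
    by (simp add: unity_roots_def)
  ultimately show ?thesis
    using sum_unity_roots_partial_fraction[OF N N order_refl, of "z\<^sup>2"] z
    by (simp add: w generic_points_def)
qed

lemma L_op_unity_roots:
  assumes "N \<ge> 1"
  shows "L_op N \<alpha> f z = z * deriv f z
    + (\<Sum>\<zeta>\<in>unity_roots N. dunkl_coeff (of_real (2 * \<alpha> + 1)) \<zeta> z * (f (\<zeta> / z) - f z))"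
  unfolding L_op_def R_op_def dunkl_coeff_def
  using sum_q_root[OF assms, of "\<lambda>\<zeta>. of_real (2 * \<alpha> + 1) * z\<^sup>2 / (\<zeta> - z\<^sup>2) * (f (\<zeta> / z) - f z)"]
  by simp

text \<open>Makes sense of iterating \<open>L\<close>: a formula for \<open>L f\<close> that is known only at generic points may be
  inserted under another \<open>L\<close>, as these points form an open set invariant under \<open>z \<mapsto> \<zeta>/z\<close>.\<close>

lemma L_op_cong:
  assumes "N \<ge> 1" "z \<in> generic_points N" "\<And>w. w \<in> generic_points N \<Longrightarrow> f w = g w"
  shows "L_op N \<alpha> f z = L_op N \<alpha> g z"
proof -
  have "deriv f z = deriv g z"
    using assms eventually_nhds_in_open[OF open_generic_points assms(2)]
    by (intro deriv_cong_ev) (auto elim: eventually_mono)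
  then show ?thesis
    using assms generic_points_divide[OF assms(2)] by (simp add: L_op_unity_roots)
qed

lemma L_op_linear:
  assumes "N \<ge> 1" "f field_differentiable at z" "g field_differentiable at z"
  shows "L_op N \<alpha> (\<lambda>w. a * f w + b * g w) z = a * L_op N \<alpha> f z + b * L_op N \<alpha> g z"
proof -
  have "deriv (\<lambda>w. a * f w + b * g w) z = a * deriv f z + b * deriv g z"
    by (intro DERIV_imp_deriv DERIV_add DERIV_cmult field_differentiable_derivI assms)
  then show ?thesis
    unfolding L_op_unity_roots[OF assms(1)]
    by (simp add: algebra_simps sum.distrib sum_distrib_left sum_subtractf)
qed

text \<open>With \<open>\<iota>\<close> the reflection \<open>z \<mapsto> 1/z\<close> and \<open>T\<^sub>\<zeta> f(z) = f(\<zeta>z)\<close>, this is the relation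
  \<open>L \<iota> + \<iota> L = Nc \<iota> - c \<Sum>\<^sub>\<zeta> T\<^sub>\<zeta>\<close>. The derivative parts cancel, and after the substitution
  \<open>\<zeta> \<mapsto> 1/\<zeta>\<close> the rest follows from \<open>A\<^bsub>1/\<zeta>\<^esub>(z) + A\<^sub>\<zeta>(1/z) = -c\<close>.\<close>

lemma L_op_reflect:
  assumes N: "N \<ge> 1" and z: "z \<in> generic_points N"
    and f: "f field_differentiable at (1 / z)"
  shows "L_op N \<alpha> (\<lambda>w. f (1 / w)) z = - L_op N \<alpha> f (1 / z)
    + of_nat N * of_real (2 * \<alpha> + 1) * f (1 / z)
    - of_real (2 * \<alpha> + 1) * (\<Sum>\<zeta>\<in>unity_roots N. f (\<zeta> * z))"
proof -
  define c where "c = (of_real (2 * \<alpha> + 1) :: complex)"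
  have z0: "z \<noteq> 0" using z by (rule generic_points_nonzero)
  have d: "deriv (\<lambda>w. f (1 / w)) z = - deriv f (1 / z) / z\<^sup>2"
  proof (rule DERIV_imp_deriv)
    have "((\<lambda>w. 1 / w) has_field_derivative - (1 / z\<^sup>2)) (at z)"
      using z0 by (auto intro!: derivative_eq_intros simp: power2_eq_square)
    from DERIV_chain2[OF field_differentiable_derivI[OF f] this]
    show "((\<lambda>w. f (1 / w)) has_field_derivative - deriv f (1 / z) / z\<^sup>2) (at z)" by simp
  qed
  have "(\<Sum>\<zeta>\<in>unity_roots N. dunkl_coeff c \<zeta> z * (f (1 / (\<zeta> / z)) - f (1 / z)))
      = (\<Sum>\<zeta>\<in>unity_roots N. dunkl_coeff c (1 / \<zeta>) z * (f (\<zeta> * z) - f (1 / z)))"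
    by (intro sum.reindex_bij_witness[where i = "\<lambda>\<zeta>. 1 / \<zeta>" and j = "\<lambda>\<zeta>. 1 / \<zeta>"])
       (auto intro!: unity_roots_divide one_in_unity_roots simp: field_simps)
  also have "\<dots> = (\<Sum>\<zeta>\<in>unity_roots N.
      (- c - dunkl_coeff c \<zeta> (1 / z)) * (f (\<zeta> * z) - f (1 / z)))"
  proof (rule sum.cong)
    fix \<zeta> assume \<zeta>: "\<zeta> \<in> unity_roots N"
    have "1 / \<zeta> \<noteq> z\<^sup>2" "\<zeta> \<noteq> 0"
      using generic_points_square_neq[OF z unity_roots_divide[OF one_in_unity_roots \<zeta>]]
        unity_roots_nonzero[OF N \<zeta>] by auto
    then have ne: "1 - \<zeta> * z\<^sup>2 \<noteq> 0" "\<zeta> \<noteq> 0" by (auto simp: field_simps)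
    have "dunkl_coeff c (1 / \<zeta>) z = c * (\<zeta> * z\<^sup>2 / (1 - \<zeta> * z\<^sup>2))"
    proof -
      have "1 / \<zeta> - z\<^sup>2 = (1 - \<zeta> * z\<^sup>2) / \<zeta>" using ne by (simp add: field_simps)
      then show ?thesis by (simp add: dunkl_coeff_def)
    qed
    moreover have "dunkl_coeff c \<zeta> (1 / z) = - c * (1 / (1 - \<zeta> * z\<^sup>2))"
    proof -
      have "\<zeta> - (1 / z)\<^sup>2 = - ((1 - \<zeta> * z\<^sup>2) / z\<^sup>2)" using z0 by (simp add: field_simps)
      then show ?thesis using z0 ne by (simp add: dunkl_coeff_def power_divide)
    qed
    moreover have "\<zeta> * z\<^sup>2 / (1 - \<zeta> * z\<^sup>2) = -1 + 1 / (1 - \<zeta> * z\<^sup>2)"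
      using ne by (simp add: field_simps)
    ultimately have "dunkl_coeff c (1 / \<zeta>) z = - c - dunkl_coeff c \<zeta> (1 / z)"
      by (simp add: algebra_simps)
    then show "dunkl_coeff c (1 / \<zeta>) z * (f (\<zeta> * z) - f (1 / z))
      = (- c - dunkl_coeff c \<zeta> (1 / z)) * (f (\<zeta> * z) - f (1 / z))" by simp
  qed simp
  also have "\<dots> = - c * (\<Sum>\<zeta>\<in>unity_roots N. f (\<zeta> * z)) + of_nat N * c * f (1 / z)
      - (\<Sum>\<zeta>\<in>unity_roots N. dunkl_coeff c \<zeta> (1 / z) * (f (\<zeta> / (1 / z)) - f (1 / z)))"
    using card_unity_roots[OF N]
    by (simp add: algebra_simps sum.distrib sum_subtractf sum_negf sum_distrib_left)
  finally show ?thesis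
    unfolding L_op_unity_roots[OF N] d c_def[symmetric] using z0
    by (simp add: power2_eq_square)
qed

section \<open>Eigenfunctions of the first-order operator\<close>

text \<open>
  With \<open>\<phi>\<^sub>j(W)\<close> the monic orthogonal polynomials on the unit circle for the weight \<open>\<bar>1 - W\<bar>\<^sup>c\<close>, this is
  the balanced form \<open>g\<^sub>j(u) = u\<^bsup>-j\<^esup> \<phi>\<^sub>j(u\<^sup>2)\<close>. In this normalisation the Szego recurrence for
  \<open>\<phi>\<^sub>j\<close> and its reversed polynomial is a single recurrence between \<open>g\<^sub>j(u)\<close> and \<open>g\<^sub>j(1/u)\<close>.
\<close>

primrec circle_gegenbauer :: "complex \<Rightarrow> nat \<Rightarrow> complex \<Rightarrow> complex" where
  "circle_gegenbauer c 0 u = 1"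
| "circle_gegenbauer c (Suc j) u = u * circle_gegenbauer c j u
     + c / (2 * of_nat (Suc j) + c) * circle_gegenbauer c j (1 / u) / u"

text \<open>The case \<open>N = 1\<close> of the eigenvalue relation for \<open>L\<close>, solved for the derivative. The induction
  closes because it is used at \<open>u\<close> and at \<open>1/u\<close> simultaneously; with
  \<open>\<kappa> = c / (2j + 2 + c)\<close>, everything in the step cancels except the multiple
  \<open>2 (j + 1 + c) \<kappa> - c (1 + \<kappa>)\<close> of \<open>g\<^sub>j(1/u) / u\<close>, and this is what determines \<open>\<kappa>\<close>.\<close>

lemma circle_gegenbauer_has_derivative:
  assumes c: "\<And>i. 2 * of_nat (Suc i) + c \<noteq> 0" and u: "u \<noteq> 0" "u\<^sup>2 \<noteq> 1"
  shows "(circle_gegenbauer c j has_field_derivative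
    ((of_nat j + c) * circle_gegenbauer c j u
      - c / (1 - u\<^sup>2) * (circle_gegenbauer c j (1 / u) - u\<^sup>2 * circle_gegenbauer c j u)) / u) (at u)"
  using u
proof (induction j arbitrary: u)
  case 0
  then have "1 - u\<^sup>2 \<noteq> 0" by simp
  then have "circle_gegenbauer c 0 = (\<lambda>_. 1)" "c / (1 - u\<^sup>2) * (1 - u\<^sup>2) = c"
    by (auto simp: fun_eq_iff)
  then show ?case by simp
next
  case (Suc j)
  let ?g = "circle_gegenbauer c j"
  define T where "T = 1 / (1 - u\<^sup>2)"
  define \<kappa> where "\<kappa> = c / (2 * of_nat (Suc j) + c)"
  have u: "u \<noteq> 0" "u\<^sup>2 \<noteq> 1" "1 - u\<^sup>2 \<noteq> 0" using Suc.prems by auto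
  have u': "1 / u \<noteq> 0" "(1 / u)\<^sup>2 \<noteq> 1" using u by (auto simp: power_divide)
  \<comment> \<open>\<open>d\<close> and \<open>d'\<close> are the derivatives of \<open>g\<^sub>j\<close> at \<open>u\<close> and at \<open>1/u\<close>, both given by the induction
    hypothesis.\<close>
  define d where "d = ((of_nat j + c) * ?g u - c * T * (?g (1 / u) - u\<^sup>2 * ?g u)) / u"
  define d' where "d' = u * ((of_nat j + c) * ?g (1 / u) + c * T * (u\<^sup>2 * ?g u - ?g (1 / u)))"
  have g1: "(?g has_field_derivative d) (at u)"
    using Suc.IH[OF u(1,2)] by (simp add: d_def T_def)
  have "(?g has_field_derivative d') (at (1 / u))"
  proof -
    have "1 / (1 - (1 / u)\<^sup>2) = - (u\<^sup>2 * T)"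
    proof -
      have "1 - (1 / u)\<^sup>2 = - ((1 - u\<^sup>2) / u\<^sup>2)" using u by (simp add: field_simps)
      then show ?thesis by (simp add: T_def)
    qed
    then have "c / (1 - (1 / u)\<^sup>2) = - (c * u\<^sup>2 * T)" by (metis mult.assoc mult_minus_right
        times_divide_eq_right mult.right_neutral)
    then have "((of_nat j + c) * ?g (1 / u) - c / (1 - (1 / u)\<^sup>2)
        * (?g (1 / (1 / u)) - (1 / u)\<^sup>2 * ?g (1 / u))) / (1 / u)
      = ((of_nat j + c) * ?g (1 / u) + c * u\<^sup>2 * T * (?g u - ?g (1 / u) / u\<^sup>2)) * u"
      by (simp only: power_divide) simp
    also have "\<dots> = d'"
      using u(1) by (simp add: d'_def algebra_simps)
    finally show ?thesis
      using Suc.IH[OF u'] by simp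
  qed
  moreover have "((\<lambda>w. 1 / w) has_field_derivative - (1 / u\<^sup>2)) (at u)"
    using u by (auto intro!: derivative_eq_intros simp: power2_eq_square)
  ultimately have g2: "((\<lambda>w. ?g (1 / w)) has_field_derivative d' * - (1 / u\<^sup>2)) (at u)"
    by (rule DERIV_chain2)
  have F: "circle_gegenbauer c (Suc j) = (\<lambda>w. w * ?g w + \<kappa> * ?g (1 / w) / w)"
    by (simp add: fun_eq_iff \<kappa>_def)
  have D: "(circle_gegenbauer c (Suc j) has_field_derivative
      ?g u + u * d + \<kappa> * (- d' / u\<^sup>2 * u - ?g (1 / u)) / u\<^sup>2) (at u)"
    unfolding F using u(1)
    by (auto intro!: derivative_eq_intros g1 g2 simp: power2_eq_square algebra_simps)
  \<comment> \<open>The two relations to which the step reduces.\<close>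
  have k: "2 * (of_nat (Suc j) + c) * \<kappa> = c * (1 + \<kappa>)"
    using c[of j] by (simp add: \<kappa>_def field_simps)
  have t: "T * u\<^sup>2 = T - 1" using u by (simp add: T_def field_simps)
  define a b where "a = ?g u" and "b = ?g (1 / u)"
  have "u * (?g u + u * d + \<kappa> * (- d' / u\<^sup>2 * u - ?g (1 / u)) / u\<^sup>2)
      = (1 + of_nat j + c) * (u * a) - c * T * u\<^sup>2 * (b / u - u * a)
        - \<kappa> * (1 + of_nat j + c) * (b / u) - \<kappa> * c * T * (u * a - b / u)"
  proof -
    have "u * (?g u + u * d + \<kappa> * (- d' / u\<^sup>2 * u - ?g (1 / u)) / u\<^sup>2)
        = u * a + u * (u * d) - \<kappa> / u * (d' / u + b)"
      unfolding a_def b_def using u(1) by (simp add: field_simps power2_eq_square)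
    moreover have "u * d = (of_nat j + c) * a - c * T * (b - u\<^sup>2 * a)"
      using u(1) by (simp add: d_def a_def b_def)
    moreover have "d' / u = (of_nat j + c) * b + c * T * (u\<^sup>2 * a - b)"
      using u(1) by (simp add: d'_def a_def b_def)
    moreover have "u * a + u * ((of_nat j + c) * a - c * T * (b - u\<^sup>2 * a))
          - \<kappa> / u * ((of_nat j + c) * b + c * T * (u\<^sup>2 * a - b) + b)
        = (1 + of_nat j + c) * (u * a) - c * T * u\<^sup>2 * (b / u - u * a)
          - \<kappa> * (1 + of_nat j + c) * (b / u) - \<kappa> * c * T * (u * a - b / u)"
      using u(1) by (simp add: algebra_simps power2_eq_square)
    ultimately show ?thesis by (simp only:)
  qed
  also have "\<dots> = (1 + of_nat j + c) * (u * a + \<kappa> * (b / u))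
      - c * T * (b / u + \<kappa> * (u * a) - u\<^sup>2 * (u * a + \<kappa> * (b / u)))"
    (is "?l = ?r")
  proof -
    have "?r - ?l = (b / u) * (2 * (of_nat (Suc j) + c) * \<kappa> - c * (1 + \<kappa>) * (T - T * u\<^sup>2))"
      by (simp add: algebra_simps del: times_divide_eq_right times_divide_eq_left)
    also have "\<dots> = 0" unfolding k t by simp
    finally show ?thesis by simp
  qed
  finally show ?case
  proof (intro DERIV_cong[OF D])
    assume *: "u * (?g u + u * d + \<kappa> * (- d' / u\<^sup>2 * u - ?g (1 / u)) / u\<^sup>2)
      = (1 + of_nat j + c) * (u * a + \<kappa> * (b / u))
        - c * T * (b / u + \<kappa> * (u * a) - u\<^sup>2 * (u * a + \<kappa> * (b / u)))"
    have g: "circle_gegenbauer c (Suc j) u = u * a + \<kappa> * (b / u)"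
      "circle_gegenbauer c (Suc j) (1 / u) = b / u + \<kappa> * (u * a)"
      by (simp_all add: a_def b_def \<kappa>_def)
    have "u * (?g u + u * d + \<kappa> * (- d' / u\<^sup>2 * u - ?g (1 / u)) / u\<^sup>2)
      = (of_nat (Suc j) + c) * circle_gegenbauer c (Suc j) u - c / (1 - u\<^sup>2)
        * (circle_gegenbauer c (Suc j) (1 / u) - u\<^sup>2 * circle_gegenbauer c (Suc j) u)"
      unfolding * g by (simp add: T_def)
    then show "?g u + u * d + \<kappa> * (- d' / u\<^sup>2 * u - ?g (1 / u)) / u\<^sup>2
      = ((of_nat (Suc j) + c) * circle_gegenbauer c (Suc j) u - c / (1 - u\<^sup>2)
        * (circle_gegenbauer c (Suc j) (1 / u) - u\<^sup>2 * circle_gegenbauer c (Suc j) u)) / u"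
      using u(1) by (metis nonzero_mult_div_cancel_left)
  qed
qed

text \<open>Since \<open>(\<zeta>/z)\<^sup>N = 1/u\<close> for every root \<open>\<zeta>\<close>, the reflections act on the factor \<open>g\<^sub>j(z\<^sup>N)\<close> all in the
  same way, and only \<open>\<Sum>\<^sub>\<zeta> A\<^sub>\<zeta> \<zeta>\<^sup>s\<close> and \<open>\<Sum>\<^sub>\<zeta> A\<^sub>\<zeta>\<close> have to be evaluated. The resulting multiple of
  \<open>g\<^sub>j(1/u) - u\<^sup>2 g\<^sub>j(u)\<close> cancels against the derivative of \<open>g\<^sub>j\<close>.\<close>

lemma L_op_eigenfunction:
  fixes \<alpha> :: real and j :: nat
  defines "c \<equiv> of_real (2 * \<alpha> + 1) :: complex"
  assumes N: "N \<ge> 1" and c: "\<And>i. 2 * of_nat (Suc i) + c \<noteq> 0"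
    and s: "1 \<le> s" "s \<le> N" and z: "z \<in> generic_points N"
  defines "e \<equiv> \<lambda>w. w ^ s * circle_gegenbauer c j (w ^ N)"
  shows "e field_differentiable at z"
    and "L_op N \<alpha> e z = (of_nat (N * j + s) + of_nat N * c) * e z"
proof -
  let ?g = "circle_gegenbauer c j" and ?u = "z ^ N"
  have z0: "z \<noteq> 0" using z by (rule generic_points_nonzero)
  have w: "(z\<^sup>2) ^ N = ?u\<^sup>2" by (simp add: power_mult[symmetric] mult.commute)
  have w': "z ^ (2 * N) = ?u\<^sup>2" by (simp add: power_mult[symmetric] mult.commute)
  have u: "?u \<noteq> 0" "?u\<^sup>2 \<noteq> 1" "1 - ?u\<^sup>2 \<noteq> 0"
    using z by (auto simp: generic_points_def w[symmetric] power_mult)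
  define d where "d = ((of_nat j + c) * ?g ?u - c / (1 - ?u\<^sup>2) * (?g (1 / ?u) - ?u\<^sup>2 * ?g ?u)) / ?u"
  then have ud: "?u * d = (of_nat j + c) * ?g ?u - c / (1 - ?u\<^sup>2) * (?g (1 / ?u) - ?u\<^sup>2 * ?g ?u)"
    using u(1) by simp
  have g: "(?g has_field_derivative d) (at ?u)"
    unfolding d_def by (rule circle_gegenbauer_has_derivative[OF c u(1,2)])
  have "((\<lambda>w. w ^ N) has_field_derivative of_nat N * z ^ (N - 1)) (at z)"
    by (auto intro!: derivative_eq_intros)
  from DERIV_chain2[OF g this]
  have "((\<lambda>w. ?g (w ^ N)) has_field_derivative d * (of_nat N * z ^ (N - 1))) (at z)" .
  then have e: "(e has_field_derivative
      of_nat s * z ^ (s - 1) * ?g ?u + z ^ s * (d * (of_nat N * z ^ (N - 1)))) (at z)"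
    unfolding e_def by (auto intro!: derivative_eq_intros)
  then show "e field_differentiable at z" by (auto simp: field_differentiable_def)
  have zs: "z * z ^ (s - 1) = z ^ s" "z * z ^ (N - 1) = ?u"
    using s N by (simp_all add: power_eq_if)
  have "z * deriv e z = of_nat s * (z * z ^ (s - 1)) * ?g ?u
      + of_nat N * z ^ s * d * (z * z ^ (N - 1))"
    by (simp add: DERIV_imp_deriv[OF e] algebra_simps)
  also have "\<dots> = z ^ s * (of_nat s * ?g ?u + of_nat N * ((of_nat j + c) * ?g ?u
      - c / (1 - ?u\<^sup>2) * (?g (1 / ?u) - ?u\<^sup>2 * ?g ?u)))"
    unfolding zs ud[symmetric] by (simp add: algebra_simps)
  finally have D: "z * deriv e z = \<dots>" .
  have S1: "z\<^sup>2 * (\<Sum>\<zeta>\<in>unity_roots N. \<zeta> ^ s / (\<zeta> - z\<^sup>2)) = z ^ s * z ^ s * of_nat N / (1 - ?u\<^sup>2)"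
  proof -
    have "z\<^sup>2 * (z\<^sup>2) ^ (s - 1) = z ^ s * z ^ s"
      using s unfolding power_Suc[symmetric] by (simp add: power2_eq_square power_mult_distrib)
    then show ?thesis
      using sum_unity_roots_partial_fraction[OF N s, of "z\<^sup>2"] u(2) by (simp add: w)
  qed
  have "(\<Sum>\<zeta>\<in>unity_roots N. dunkl_coeff c \<zeta> z * (e (\<zeta> / z) - e z))
    = (\<Sum>\<zeta>\<in>unity_roots N. c * ?g (1 / ?u) / z ^ s * (z\<^sup>2 * (\<zeta> ^ s / (\<zeta> - z\<^sup>2)))
        - c * e z * (z\<^sup>2 * (1 / (\<zeta> - z\<^sup>2))))"
  proof (rule sum.cong)
    fix \<zeta> assume \<zeta>: "\<zeta> \<in> unity_roots N"
    then have "e (\<zeta> / z) = \<zeta> ^ s / z ^ s * ?g (1 / ?u)"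
      by (simp add: e_def power_divide unity_roots_def)
    then show "dunkl_coeff c \<zeta> z * (e (\<zeta> / z) - e z) =
        c * ?g (1 / ?u) / z ^ s * (z\<^sup>2 * (\<zeta> ^ s / (\<zeta> - z\<^sup>2))) - c * e z * (z\<^sup>2 * (1 / (\<zeta> - z\<^sup>2)))"
      by (simp add: dunkl_coeff_def right_diff_distrib mult_ac)
  qed simp
  also have "\<dots> = c * ?g (1 / ?u) / z ^ s * (z\<^sup>2 * (\<Sum>\<zeta>\<in>unity_roots N. \<zeta> ^ s / (\<zeta> - z\<^sup>2)))
      - c * e z * (z\<^sup>2 * (\<Sum>\<zeta>\<in>unity_roots N. 1 / (\<zeta> - z\<^sup>2)))"
    unfolding sum_subtractf sum_distrib_left ..
  also have "\<dots> = of_nat N * z ^ s * (c / (1 - ?u\<^sup>2) * (?g (1 / ?u) - ?u\<^sup>2 * ?g ?u))"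
    unfolding S1 sum_unity_roots_Cauchy[OF N z] w' e_def using z0 by (simp add: algebra_simps)
  finally show "L_op N \<alpha> e z = (of_nat (N * j + s) + of_nat N * c) * e z"
    unfolding L_op_unity_roots[OF N] c_def[symmetric] D by (simp add: e_def algebra_simps)
qed

text \<open>The correction term comes from \<open>\<Sum>\<^sub>\<zeta> T\<^sub>\<zeta>\<close>, which averages over rotations: it annihilates
  \<open>z\<^sup>s g\<^sub>j(z\<^sup>N)\<close> unless \<open>N\<close> divides \<open>s\<close>.\<close>

lemma L_op_reflected_eigenfunction:
  fixes \<alpha> :: real and j :: nat
  defines "c \<equiv> of_real (2 * \<alpha> + 1) :: complex"
  assumes N: "N \<ge> 1" and c: "\<And>i. 2 * of_nat (Suc i) + c \<noteq> 0"
    and s: "1 \<le> s" "s \<le> N" and z: "z \<in> generic_points N"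
  defines "e \<equiv> \<lambda>w. w ^ s * circle_gegenbauer c j (w ^ N)"
  shows "L_op N \<alpha> (\<lambda>w. e (1 / w)) z =
    - of_nat (N * j + s) * e (1 / z) - (if s = N then of_nat N * c else 0) * e z"
proof -
  have z': "1 / z \<in> generic_points N"
    by (rule generic_points_divide[OF z one_in_unity_roots N])
  note eig = L_op_eigenfunction[OF N c[unfolded c_def] s z', of j, folded c_def e_def]
  have "L_op N \<alpha> e (1 / z) = (of_nat (N * j + s) + of_nat N * c) * e (1 / z)"
    using eig(2) by (simp only: e_def)
  note eig = eig(1) this
  have "e (\<zeta> * z) = \<zeta> ^ s * e z" if "\<zeta> \<in> unity_roots N" for \<zeta>
    using that by (simp add: e_def power_mult_distrib unity_roots_def)
  then have "(\<Sum>\<zeta>\<in>unity_roots N. e (\<zeta> * z)) = (\<Sum>\<zeta>\<in>unity_roots N. \<zeta> ^ s) * e z"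
    by (simp add: sum_distrib_right)
  also have "(\<Sum>\<zeta>\<in>unity_roots N. \<zeta> ^ s) = (if s = N then of_nat N else 0)"
    using s by (auto simp: sum_unity_roots_power[OF N] dest: dvd_imp_le)
  finally have T: "(\<Sum>\<zeta>\<in>unity_roots N. e (\<zeta> * z)) = (if s = N then of_nat N else 0) * e z" .
  show ?thesis
    unfolding L_op_reflect[OF N z eig(1)] eig(2) T c_def[symmetric] by (simp add: algebra_simps)
qed

text \<open>On the span of \<open>e\<close> and its reflection \<open>L\<close> is triangular with diagonal entries
  \<open>\<lambda> = n + Nc\<close> and \<open>\<mu> = -n\<close>. As \<open>\<lambda> + \<mu> = Nc\<close>, the Cayley-Hamilton theorem says
  that \<open>L\<^sup>2 - Nc L\<close> is the scalar \<open>-\<lambda>\<mu> = n (n + Nc)\<close>, whatever the off-diagonal entry \<open>\<kappa>\<close> is.\<close>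

lemma H_op_eigenfunction:
  fixes \<alpha> :: real and j :: nat
  defines "c \<equiv> of_real (2 * \<alpha> + 1) :: complex"
  assumes N: "N \<ge> 1" and c: "\<And>i. 2 * of_nat (Suc i) + c \<noteq> 0"
    and s: "1 \<le> s" "s \<le> N" and z: "z \<in> generic_points N"
  defines "e \<equiv> \<lambda>w. w ^ s * circle_gegenbauer c j (w ^ N)"
    and "n \<equiv> of_nat (N * j + s)"
  assumes f: "\<And>w. w \<in> generic_points N \<Longrightarrow> f w = e w + e (1 / w)"
  shows "H_op N \<alpha> f z = n * (n + of_nat N * c) * f z"
proof -
  define \<kappa> where "\<kappa> = (if s = N then of_nat N * c else 0)"
  have eig: "e field_differentiable at w" "L_op N \<alpha> e w = (n + of_nat N * c) * e w"
    and eig': "L_op N \<alpha> (\<lambda>w. e (1 / w)) w = - n * e (1 / w) - \<kappa> * e w"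
    if w: "w \<in> generic_points N" for w
    using L_op_eigenfunction[OF N c[unfolded c_def] s w, of j]
      L_op_reflected_eigenfunction[OF N c[unfolded c_def] s w, of j]
    by (simp_all only: c_def e_def n_def \<kappa>_def)
  have diff': "(\<lambda>w. e (1 / w)) field_differentiable at w" if w: "w \<in> generic_points N" for w
  proof -
    have "((\<lambda>w. 1 / w) has_field_derivative - (1 / w\<^sup>2)) (at w)"
      using generic_points_nonzero[OF w]
      by (auto intro!: derivative_eq_intros simp: power2_eq_square)
    from DERIV_chain2[OF field_differentiable_derivI[OF
          eig(1)[OF generic_points_divide[OF w one_in_unity_roots N]]] this]
    show ?thesis by (auto simp: field_differentiable_def)
  qed
  have lin: "L_op N \<alpha> (\<lambda>w. a * e w + b * e (1 / w)) w
      = (a * (n + of_nat N * c) - b * \<kappa>) * e w - b * n * e (1 / w)"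
    if w: "w \<in> generic_points N" for a b w
    unfolding L_op_linear[OF N eig(1)[OF w] diff'[OF w]] eig(2)[OF w] eig'[OF w]
    by (simp add: algebra_simps)
  have Lf: "L_op N \<alpha> f w = (n + of_nat N * c - \<kappa>) * e w + (- n) * e (1 / w)"
    if w: "w \<in> generic_points N" for w
    using L_op_cong[OF N w, of f "\<lambda>w. 1 * e w + 1 * e (1 / w)" \<alpha>] lin[OF w, of 1 1] f by simp
  have "L_op N \<alpha> (L_op N \<alpha> f) z
      = L_op N \<alpha> (\<lambda>w. (n + of_nat N * c - \<kappa>) * e w + (- n) * e (1 / w)) z"
    using Lf by (intro L_op_cong[OF N z])
  then show ?thesis
    unfolding H_op_def c_def[symmetric] lin[OF z] Lf[OF z] f[OF z] by (simp add: algebra_simps)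
qed

section \<open>Sieved polynomials\<close>

text \<open>The ultraspherical coefficients \<open>a\<^bsub>k-1\<^esub>\<close> vanish for odd \<open>k\<close>; this is why the period is \<open>2N\<close>
  and not \<open>N\<close>.\<close>

lemma sieved_param_eq_0:
  assumes "N \<ge> 1" "\<not> 2 * N dvd n + 1"
  shows "sieved_param N \<alpha> n = 0"
proof (cases "N dvd n + 1")
  case True
  then obtain k where k: "n + 1 = N * k" by (elim dvdE)
  have "odd k"
  proof
    assume "even k"
    then show False using assms k by (auto elim!: evenE)
  qed
  then have "(n + 1) div N - 1 + 1 = k" using k assms by (cases k) auto
  then show ?thesis using \<open>odd k\<close> by (auto simp: sieved_param_def jacobi_param_def)
qed (simp add: sieved_param_def)

lemma sieved_param_multiple:
  assumes "N \<ge> 1"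
  shows "sieved_param N \<alpha> (2 * N * Suc j - 1) = - ((2 * \<alpha> + 1) / (2 * real (Suc j) + (2 * \<alpha> + 1)))"
proof -
  have "2 * N * Suc j - 1 + 1 = N * (2 * Suc j)" using assms by simp
  then have "sieved_param N \<alpha> (2 * N * Suc j - 1) = jacobi_param \<alpha> (2 * Suc j - 1)"
    using assms unfolding sieved_param_def
    by (metis dvd_triv_left nonzero_mult_div_cancel_left not_one_le_zero)
  also have "\<dots> = - ((2 * \<alpha> + 1) / (2 * real (Suc j) + (2 * \<alpha> + 1)))"
  proof -
    have "(\<alpha> + 1 / 2) * (1 + (-1) ^ (2 * Suc j - 1 + 1)) = 2 * \<alpha> + 1"
      by (simp add: algebra_simps)
    moreover have "real (2 * Suc j - 1) + 2 * \<alpha> + 2 = 2 * real (Suc j) + (2 * \<alpha> + 1)"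
      by simp
    ultimately show ?thesis unfolding jacobi_param_def by (simp only: minus_divide_left)
  qed
  finally show ?thesis .
qed

lemma poly_sieved_Phi_between:
  assumes N: "N \<ge> 1" and r: "r < 2 * N"
  shows "poly (sieved_Phi N \<alpha> (2 * N * j + r)) z = z ^ r * poly (sieved_Phi N \<alpha> (2 * N * j)) z"
  using r
proof (induction r)
  case (Suc r)
  have "\<not> 2 * N dvd 2 * N * j + r + 1"
  proof
    assume "2 * N dvd 2 * N * j + r + 1"
    then have "2 * N dvd r + 1"
      by (metis add.assoc dvd_add_right_iff dvd_triv_left)
    then show False using Suc.prems by (auto dest: dvd_imp_le)
  qed
  then show ?case
    using Suc by (simp add: sieved_param_eq_0[OF N])
qed simp

text \<open>Over one full period the recurrence for \<open>\<Phi>\<close> is \<open>2N - 1\<close> multiplications by \<open>z\<close> followed by one step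
  with coefficient \<open>-c / (2j + 2 + c)\<close>, which is the defining recurrence of \<open>g\<^sub>j\<close> in \<open>u = z\<^sup>N\<close>.\<close>

lemma poly_sieved_Phi_multiple:
  fixes \<alpha> :: real and j :: nat
  assumes N: "N \<ge> 1" and z: "z \<noteq> 0"
  shows "poly (sieved_Phi N \<alpha> (2 * N * j)) z
    = z ^ (N * j) * circle_gegenbauer (of_real (2 * \<alpha> + 1)) j (z ^ N)"
  using z
proof (induction j arbitrary: z)
  case (Suc j)
  let ?c = "of_real (2 * \<alpha> + 1) :: complex" and ?g = "circle_gegenbauer (of_real (2 * \<alpha> + 1)) j"
  let ?m = "2 * N * j + (2 * N - 1)" and ?u = "z ^ N"
  have m: "2 * N * Suc j = Suc ?m" using N by simp
  have p: "- of_real (sieved_param N \<alpha> ?m) = ?c / (2 * of_nat (Suc j) + ?c)"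
  proof -
    have "?m = 2 * N * Suc j - 1" using N by simp
    then show ?thesis using sieved_param_multiple[OF N, of \<alpha> j] by simp
  qed
  have zm: "poly (sieved_Phi N \<alpha> ?m) w = w ^ (2 * N - 1) * (w ^ (N * j) * ?g (w ^ N))"
    if "w \<noteq> 0" for w
    using Suc.IH[OF that] N by (subst poly_sieved_Phi_between) auto
  have z0: "z \<noteq> 0" "1 / z \<noteq> 0" using Suc.prems by auto
  have e1: "z * z ^ (2 * N - 1) = ?u * ?u"
    using N by (simp add: power_add[symmetric] mult_2 flip: power_Suc)
  have e2: "z ^ ?m * ((1 / z) ^ (2 * N - 1) * (1 / z) ^ (N * j)) = z ^ (N * j)"
    using z0 by (simp add: power_add power_mult power_divide mult.commute[of _ 2]
        power2_eq_square power_mult_distrib)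
  have e3: "z ^ (N * Suc j) = z ^ (N * j) * ?u" by (simp add: power_add)
  have "poly (sieved_Phi N \<alpha> (2 * N * Suc j)) z
      = z * poly (sieved_Phi N \<alpha> ?m) z
        + (- of_real (sieved_param N \<alpha> ?m)) * z ^ ?m * poly (sieved_Phi N \<alpha> ?m) (1 / z)"
    unfolding m poly_sieved_Phi_Suc[OF z0(1)] by simp
  also have "\<dots> = (z * z ^ (2 * N - 1)) * z ^ (N * j) * ?g ?u
      + ?c / (2 * of_nat (Suc j) + ?c)
        * (z ^ ?m * ((1 / z) ^ (2 * N - 1) * (1 / z) ^ (N * j))) * ?g (1 / ?u)"
    unfolding zm[OF z0(1)] zm[OF z0(2)] p power_one_over by (simp only: mult_ac)
  also have "\<dots> = z ^ (N * Suc j) * circle_gegenbauer ?c (Suc j) ?u"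
  proof -
    define \<kappa> where "\<kappa> = ?c / (2 * of_nat (Suc j) + ?c)"
    show ?thesis
      unfolding e1 e2 e3 circle_gegenbauer.simps \<kappa>_def[symmetric] using z0
      by (simp add: algebra_simps)
  qed
  finally show ?case .
qed simp

text \<open>Here \<open>2n - 1 = 2Nj + (2s - 1)\<close>, so the power of \<open>z\<close> in \<open>z\<^bsup>1-n\<^esup> \<Phi>\<^bsub>2n-1\<^esub>(z)\<close> is
  \<open>(1 - n) + (2s - 1) + jN = s\<close>.\<close>

lemma poly_sieved_ultraspherical:
  fixes \<alpha> :: real and j :: nat
  assumes N: "N \<ge> 1" and s: "1 \<le> s" "s \<le> N" and z: "z \<noteq> 0"
  defines "e \<equiv> \<lambda>w. w ^ s * circle_gegenbauer (of_real (2 * \<alpha> + 1)) j (w ^ N)"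
  shows "poly (sieved_ultraspherical N \<alpha> (N * j + s)) (z + 1 / z) = e z + e (1 / z)"
proof -
  let ?n = "N * j + s"
  have n: "2 * ?n - 1 = 2 * N * j + (2 * s - 1)" "?n \<ge> 1" using s by auto
  have *: "w powi (1 - int ?n) * poly (sieved_Phi N \<alpha> (2 * ?n - 1)) w = e w" if w: "w \<noteq> 0" for w
  proof -
    have "poly (sieved_Phi N \<alpha> (2 * ?n - 1)) w
        = w ^ (2 * s - 1) * (w ^ (N * j) * circle_gegenbauer (of_real (2 * \<alpha> + 1)) j (w ^ N))"
      unfolding n using s N poly_sieved_Phi_multiple[OF N w]
      by (subst poly_sieved_Phi_between) auto
    moreover have "w powi (1 - int ?n) * (w ^ (2 * s - 1) * w ^ (N * j)) = w ^ s"
    proof -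
      have "w powi (1 - int ?n) * (w ^ (2 * s - 1) * w ^ (N * j))
          = w powi (1 - int ?n + int (2 * s - 1) + int (N * j))"
        using w by (simp only: power_int_add power_int_of_nat mult.assoc simp_thms)
      also have "1 - int ?n + int (2 * s - 1) + int (N * j) = int s" using s by simp
      finally show ?thesis by simp
    qed
    ultimately show ?thesis by (simp add: e_def mult.assoc[symmetric])
  qed
  have "z powi (int ?n - 1) = (1 / z) powi (1 - int ?n)"
    using power_int_minus[of z "1 - int ?n"]
    by (simp only: power_int_one_over inverse_eq_divide minus_diff_eq)
  with is_sieved_ultraspherical_sieved_ultraspherical[of N \<alpha> ?n] n(2) *[OF z] *[of "1 / z"] z
  show ?thesis by (simp add: is_sieved_ultraspherical_def)
qed

section \<open>The second-order form of the operator\<close>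

lemma sum_dunkl_coeff:
  assumes "N \<ge> 1" "z \<in> generic_points N"
  shows "(\<Sum>\<zeta>\<in>unity_roots N. dunkl_coeff c \<zeta> z) = c * of_nat N * z ^ (2 * N) / (1 - z ^ (2 * N))"
proof -
  have "(\<Sum>\<zeta>\<in>unity_roots N. dunkl_coeff c \<zeta> z) = c * (z\<^sup>2 * (\<Sum>\<zeta>\<in>unity_roots N. 1 / (\<zeta> - z\<^sup>2)))"
    by (simp add: dunkl_coeff_def sum_distrib_left mult.assoc)
  then show ?thesis by (simp add: sum_unity_roots_Cauchy[OF assms] mult_ac)
qed

text \<open>Naming the root as \<open>\<eta>\<^sup>2 / \<nu>\<close> makes the denominator after the reflection \<open>z \<mapsto> \<eta>/z\<close>
  one of the original denominators \<open>\<nu> - z\<^sup>2\<close>.\<close>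

lemma dunkl_coeff_reflect:
  assumes "z \<noteq> 0" "\<eta> \<noteq> 0" "\<nu> \<noteq> 0"
  shows "dunkl_coeff c (\<eta>\<^sup>2 / \<nu>) (\<eta> / z) = - c * \<nu> / (\<nu> - z\<^sup>2)"
proof (cases "\<nu> = z\<^sup>2")
  case False
  have "\<eta>\<^sup>2 / \<nu> - (\<eta> / z)\<^sup>2 = - ((\<eta> / z)\<^sup>2 * (\<nu> - z\<^sup>2) / \<nu>)"
    using assms by (simp add: field_simps)
  then show ?thesis using assms by (simp add: dunkl_coeff_def)
qed (use assms in \<open>simp add: dunkl_coeff_def power_divide\<close>)

lemma sum_dunkl_coeff_reflect:
  assumes N: "N \<ge> 1" and z: "z \<in> generic_points N" and \<eta>: "\<eta> \<in> unity_roots N"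
  shows "(\<Sum>\<zeta>\<in>unity_roots N. dunkl_coeff c \<zeta> (\<eta> / z))
    = - (c * of_nat N + (\<Sum>\<zeta>\<in>unity_roots N. dunkl_coeff c \<zeta> z))"
proof -
  have z0: "z \<noteq> 0" and \<eta>0: "\<eta> \<noteq> 0"
    using generic_points_nonzero[OF z] unity_roots_nonzero[OF N \<eta>] .
  have "(\<Sum>\<zeta>\<in>unity_roots N. dunkl_coeff c \<zeta> (\<eta> / z))
      = (\<Sum>\<nu>\<in>unity_roots N. dunkl_coeff c (\<eta>\<^sup>2 / \<nu>) (\<eta> / z))"
    using \<eta> \<eta>0 unity_roots_nonzero[OF N]
    by (intro sum.reindex_bij_witness[where i = "\<lambda>\<nu>. \<eta>\<^sup>2 / \<nu>" and j = "\<lambda>\<nu>. \<eta>\<^sup>2 / \<nu>"])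
       (auto intro!: unity_roots_divide unity_roots_mult simp: power2_eq_square)
  also have "\<dots> = (\<Sum>\<nu>\<in>unity_roots N. - c - dunkl_coeff c \<nu> z)"
  proof (rule sum.cong)
    fix \<nu> assume \<nu>: "\<nu> \<in> unity_roots N"
    then have ne: "\<nu> - z\<^sup>2 \<noteq> 0" using generic_points_square_neq[OF z] by auto
    have "- c * \<nu> / (\<nu> - z\<^sup>2) = - c - dunkl_coeff c \<nu> z"
      using ne by (simp add: dunkl_coeff_def field_simps)
    then show "dunkl_coeff c (\<eta>\<^sup>2 / \<nu>) (\<eta> / z) = - c - dunkl_coeff c \<nu> z"
      using dunkl_coeff_reflect[OF z0 \<eta>0 unity_roots_nonzero[OF N \<nu>]] by simp
  qed simp
  finally show ?thesis using card_unity_roots[OF N] by (simp add: sum_subtractf mult.commute)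
qed

text \<open>By partial fractions each summand is a constant multiple of
  \<open>1 / (\<eta>\<mu> - z\<^sup>2) - 1 / (\<eta> - z\<^sup>2)\<close>, and multiplication by \<open>\<mu>\<close> permutes the roots.\<close>

lemma sum_dunkl_coeff_product:
  assumes N: "N \<ge> 1" and z: "z \<in> generic_points N"
    and \<mu>: "\<mu> \<in> unity_roots N" "\<mu> \<noteq> 1"
  shows "(\<Sum>\<eta>\<in>unity_roots N. dunkl_coeff c \<eta> z * dunkl_coeff c (\<eta> / \<mu>) (\<eta> / z)) = 0"
proof -
  have z0: "z \<noteq> 0" and \<mu>0: "\<mu> \<noteq> 0"
    using generic_points_nonzero[OF z] unity_roots_nonzero[OF N \<mu>(1)] .
  have "(\<Sum>\<eta>\<in>unity_roots N. dunkl_coeff c \<eta> z * dunkl_coeff c (\<eta> / \<mu>) (\<eta> / z))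
      = (\<Sum>\<eta>\<in>unity_roots N. - c\<^sup>2 * z\<^sup>2 * \<mu> / (1 - \<mu>) * (1 / (\<eta> * \<mu> - z\<^sup>2) - 1 / (\<eta> - z\<^sup>2)))"
  proof (rule sum.cong)
    fix \<eta> assume \<eta>: "\<eta> \<in> unity_roots N"
    have ne: "\<eta> - z\<^sup>2 \<noteq> 0" "\<eta> * \<mu> - z\<^sup>2 \<noteq> 0" "\<eta> \<noteq> 0" "1 - \<mu> \<noteq> 0"
      using generic_points_square_neq[OF z \<eta>] \<mu>(2) unity_roots_nonzero[OF N \<eta>]
        generic_points_square_neq[OF z unity_roots_mult[OF \<eta> \<mu>(1)]] by auto
    have "\<eta> / \<mu> = \<eta>\<^sup>2 / (\<eta> * \<mu>)" using ne by (simp add: power2_eq_square)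
    then have "dunkl_coeff c (\<eta> / \<mu>) (\<eta> / z) = - c * (\<eta> * \<mu>) / (\<eta> * \<mu> - z\<^sup>2)"
      using dunkl_coeff_reflect[OF z0 ne(3), of "\<eta> * \<mu>"] ne \<mu>0 by simp
    moreover have "1 / (\<eta> * \<mu> - z\<^sup>2) - 1 / (\<eta> - z\<^sup>2)
        = (1 - \<mu>) * (\<eta> / ((\<eta> * \<mu> - z\<^sup>2) * (\<eta> - z\<^sup>2)))"
      using ne(1,2) by (simp add: divide_simps) (simp add: algebra_simps)
    ultimately show "dunkl_coeff c \<eta> z * dunkl_coeff c (\<eta> / \<mu>) (\<eta> / z)
        = - c\<^sup>2 * z\<^sup>2 * \<mu> / (1 - \<mu>) * (1 / (\<eta> * \<mu> - z\<^sup>2) - 1 / (\<eta> - z\<^sup>2))"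
      using ne(4) by (simp add: dunkl_coeff_def power2_eq_square mult_ac)
  qed simp
  also have "\<dots> = - c\<^sup>2 * z\<^sup>2 * \<mu> / (1 - \<mu>) *
      ((\<Sum>\<eta>\<in>unity_roots N. 1 / (\<eta> * \<mu> - z\<^sup>2)) - (\<Sum>\<eta>\<in>unity_roots N. 1 / (\<eta> - z\<^sup>2)))"
    unfolding sum_subtractf[symmetric] sum_distrib_left ..
  also have "(\<Sum>\<eta>\<in>unity_roots N. 1 / (\<eta> * \<mu> - z\<^sup>2)) = (\<Sum>\<eta>\<in>unity_roots N. 1 / (\<eta> - z\<^sup>2))"
    using \<mu> \<mu>0
    by (intro sum.reindex_bij_witness[where i = "\<lambda>\<eta>. \<eta> / \<mu>" and j = "\<lambda>\<eta>. \<eta> * \<mu>"])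
       (auto intro: unity_roots_mult unity_roots_divide)
  finally show ?thesis by simp
qed

text \<open>The double sum in \<open>L\<^sup>2 f\<close>, for \<open>F \<zeta> = f(\<zeta>/z) - f(z)\<close>. Collecting the terms with \<open>F (\<eta>/\<zeta>)\<close>
  by the value \<open>\<mu> = \<eta>/\<zeta>\<close> gives zero by \<open>sum_dunkl_coeff_product\<close> for \<open>\<mu> \<noteq> 1\<close> and by \<open>F 1 = 0\<close>, that is
  by symmetry of \<open>f\<close>, for \<open>\<mu> = 1\<close>. In the other terms the sum \<open>S\<close> of all \<open>A\<^sub>\<zeta>\<close> occurs once
  with each sign, and \<open>Nc\<close> is left over.\<close>

lemma sum_dunkl_coeff_commutator:
  fixes c :: complex
  assumes N: "N \<ge> 1" and z: "z \<in> generic_points N" and F: "F 1 = 0"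
  defines "A \<equiv> \<lambda>\<zeta>. dunkl_coeff c \<zeta> z"
  shows "(\<Sum>\<eta>\<in>unity_roots N. A \<eta> * ((\<Sum>\<zeta>\<in>unity_roots N.
      dunkl_coeff c \<zeta> (\<eta> / z) * (F (\<eta> / \<zeta>) - F \<eta>)) - (\<Sum>\<zeta>\<in>unity_roots N. A \<zeta> * F \<zeta>)))
    = of_nat N * c * (\<Sum>\<zeta>\<in>unity_roots N. A \<zeta> * F \<zeta>)"
proof -
  let ?Z = "unity_roots N" and ?A' = "\<lambda>\<eta> \<zeta>. dunkl_coeff c \<zeta> (\<eta> / z)"
  define S G where "S = sum A ?Z" and "G = (\<Sum>\<zeta>\<in>?Z. A \<zeta> * F \<zeta>)"
  have "(\<Sum>\<eta>\<in>?Z. \<Sum>\<zeta>\<in>?Z. A \<eta> * ?A' \<eta> \<zeta> * F (\<eta> / \<zeta>))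
      = (\<Sum>\<eta>\<in>?Z. \<Sum>\<mu>\<in>?Z. A \<eta> * ?A' \<eta> (\<eta> / \<mu>) * F \<mu>)"
  proof (rule sum.cong)
    fix \<eta> assume "\<eta> \<in> ?Z"
    then show "(\<Sum>\<zeta>\<in>?Z. A \<eta> * ?A' \<eta> \<zeta> * F (\<eta> / \<zeta>))
        = (\<Sum>\<mu>\<in>?Z. A \<eta> * ?A' \<eta> (\<eta> / \<mu>) * F \<mu>)"
      using unity_roots_nonzero[OF N]
      by (intro sum.reindex_bij_witness[where i = "\<lambda>\<mu>. \<eta> / \<mu>" and j = "\<lambda>\<mu>. \<eta> / \<mu>"])
         (auto intro: unity_roots_divide)
  qed simp
  also have "\<dots> = (\<Sum>\<mu>\<in>?Z. (\<Sum>\<eta>\<in>?Z. A \<eta> * ?A' \<eta> (\<eta> / \<mu>)) * F \<mu>)"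
    by (subst sum.swap) (simp add: sum_distrib_right)
  also have "\<dots> = 0"
    using sum_dunkl_coeff_product[OF N z, of _ c] F unfolding A_def
    by (intro sum.neutral) (metis mult_zero_left mult_zero_right)
  finally have 1: "(\<Sum>\<eta>\<in>?Z. \<Sum>\<zeta>\<in>?Z. A \<eta> * ?A' \<eta> \<zeta> * F (\<eta> / \<zeta>)) = 0" .
  have "(\<Sum>\<eta>\<in>?Z. A \<eta> * ((\<Sum>\<zeta>\<in>?Z. ?A' \<eta> \<zeta> * (F (\<eta> / \<zeta>) - F \<eta>)) - G))
      = (\<Sum>\<eta>\<in>?Z. (\<Sum>\<zeta>\<in>?Z. A \<eta> * ?A' \<eta> \<zeta> * F (\<eta> / \<zeta>))
          - A \<eta> * F \<eta> * (\<Sum>\<zeta>\<in>?Z. ?A' \<eta> \<zeta>) - A \<eta> * G)"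
    by (simp add: algebra_simps sum_subtractf sum_distrib_left)
  also have "\<dots> = (\<Sum>\<eta>\<in>?Z. (\<Sum>\<zeta>\<in>?Z. A \<eta> * ?A' \<eta> \<zeta> * F (\<eta> / \<zeta>))
          + (c * of_nat N + S) * (A \<eta> * F \<eta>) - A \<eta> * G)"
    by (intro sum.cong) (auto simp: sum_dunkl_coeff_reflect[OF N z] S_def A_def algebra_simps)
  also have "\<dots> = of_nat N * c * G"
  proof -
    have "(\<Sum>\<eta>\<in>?Z. (c * of_nat N + S) * (A \<eta> * F \<eta>)) = (c * of_nat N + S) * G"
      by (simp only: G_def sum_distrib_left)
    moreover have "(\<Sum>\<eta>\<in>?Z. A \<eta> * G) = S * G"
      by (simp only: S_def sum_distrib_right)
    ultimately show ?thesis
      unfolding sum.distrib sum_subtractf 1 by (simp only:) (simp add: algebra_simps)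
  qed
  finally show ?thesis unfolding G_def .
qed

text \<open>The plain expansion of \<open>L\<^sup>2\<close>. Differentiating \<open>f(\<zeta>/z)\<close> in the outer derivative and reflecting \<open>z f'(z)\<close> in
  the outer difference part produce the same terms \<open>A\<^sub>\<zeta> (\<zeta>/z) f'(\<zeta>/z)\<close> with opposite signs.\<close>

lemma L_op_L_op:
  fixes \<alpha> :: real
  defines "c \<equiv> of_real (2 * \<alpha> + 1) :: complex"
  assumes N: "N \<ge> 1" and z: "z \<in> generic_points N" and f: "f holomorphic_on - {0}"
  shows "L_op N \<alpha> (L_op N \<alpha> f) z = z * deriv f z + z\<^sup>2 * deriv (deriv f) z
    - 2 * (\<Sum>\<zeta>\<in>unity_roots N. dunkl_coeff c \<zeta> z) * (z * deriv f z)
    + (\<Sum>\<zeta>\<in>unity_roots N. 2 * c * \<zeta> * z\<^sup>2 / (\<zeta> - z\<^sup>2)\<^sup>2 * (f (\<zeta> / z) - f z))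
    + (\<Sum>\<eta>\<in>unity_roots N. dunkl_coeff c \<eta> z *
        ((\<Sum>\<zeta>\<in>unity_roots N. dunkl_coeff c \<zeta> (\<eta> / z) * (f (\<zeta> / (\<eta> / z)) - f (\<eta> / z)))
          - (\<Sum>\<zeta>\<in>unity_roots N. dunkl_coeff c \<zeta> z * (f (\<zeta> / z) - f z))))"
proof -
  let ?Z = "unity_roots N" and ?A = "\<lambda>\<zeta>. dunkl_coeff c \<zeta> z" and ?f' = "deriv f"
  let ?B = "\<lambda>\<zeta>. 2 * c * \<zeta> * z\<^sup>2 / (\<zeta> - z\<^sup>2)\<^sup>2"
  note L = L_op_unity_roots[OF N, of \<alpha>, folded c_def]
  have z0: "z \<noteq> 0" using z by (rule generic_points_nonzero)
  have f1: "(f has_field_derivative ?f' w) (at w)" if "w \<noteq> 0" for w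
    using holomorphic_derivI[OF f] that by auto
  have f2: "(?f' has_field_derivative deriv ?f' w) (at w)" if "w \<noteq> 0" for w
    using holomorphic_derivI[OF holomorphic_deriv[OF f]] that by auto
  have term_deriv: "((\<lambda>w. dunkl_coeff c \<zeta> w * (f (\<zeta> / w) - f w)) has_field_derivative
      ?B \<zeta> / z * (f (\<zeta> / z) - f z) - ?A \<zeta> * (\<zeta> / z\<^sup>2 * ?f' (\<zeta> / z) + ?f' z)) (at z)"
    if \<zeta>: "\<zeta> \<in> ?Z" for \<zeta>
  proof -
    have ne: "\<zeta> - z\<^sup>2 \<noteq> 0" "\<zeta> / z \<noteq> 0"
      using generic_points_square_neq[OF z \<zeta>] unity_roots_nonzero[OF N \<zeta>] z0 by auto
    have A: "(dunkl_coeff c \<zeta> has_field_derivative ?B \<zeta> / z) (at z)"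
    proof -
      have "((\<lambda>w. c * w\<^sup>2 / (\<zeta> - w\<^sup>2)) has_field_derivative
          (c * (2 * z) * (\<zeta> - z\<^sup>2) - c * z\<^sup>2 * (- (2 * z))) / (\<zeta> - z\<^sup>2)\<^sup>2) (at z)"
        using ne(1) by (auto intro!: derivative_eq_intros simp: power2_eq_square)
      moreover have "c * (2 * z) * (\<zeta> - z\<^sup>2) - c * z\<^sup>2 * (- (2 * z)) = 2 * c * \<zeta> * z\<^sup>2 / z"
        using z0 by (simp add: algebra_simps power2_eq_square)
      ultimately show ?thesis unfolding dunkl_coeff_def by (simp add: mult.commute)
    qed
    have "((\<lambda>w. \<zeta> / w) has_field_derivative - (\<zeta> / z\<^sup>2)) (at z)"
      using z0 by (auto intro!: derivative_eq_intros simp: power2_eq_square)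
    from DERIV_chain2[OF f1[OF ne(2)] this]
    have R: "((\<lambda>w. f (\<zeta> / w)) has_field_derivative ?f' (\<zeta> / z) * - (\<zeta> / z\<^sup>2)) (at z)" .
    show ?thesis
      by (rule DERIV_cong[OF DERIV_mult[OF A DERIV_diff[OF R f1[OF z0]]]])
         (simp add: algebra_simps)
  qed
  have "(L_op N \<alpha> f has_field_derivative ?f' z + z * deriv ?f' z
      + (\<Sum>\<zeta>\<in>?Z. ?B \<zeta> / z * (f (\<zeta> / z) - f z) - ?A \<zeta> * (\<zeta> / z\<^sup>2 * ?f' (\<zeta> / z) + ?f' z))) (at z)"
    unfolding L
    by (rule DERIV_cong[OF DERIV_add[OF DERIV_mult[OF DERIV_ident f2[OF z0]] DERIV_sum[OF term_deriv]]])
       simp_all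
  then have D: "z * deriv (L_op N \<alpha> f) z = z * ?f' z + z\<^sup>2 * deriv ?f' z
      + z * (\<Sum>\<zeta>\<in>?Z. ?B \<zeta> / z * (f (\<zeta> / z) - f z) - ?A \<zeta> * (\<zeta> / z\<^sup>2 * ?f' (\<zeta> / z) + ?f' z))"
    by (simp add: DERIV_imp_deriv algebra_simps power2_eq_square)
  have Dsum: "z * (\<Sum>\<zeta>\<in>?Z. ?B \<zeta> / z * (f (\<zeta> / z) - f z) - ?A \<zeta> * (\<zeta> / z\<^sup>2 * ?f' (\<zeta> / z) + ?f' z))
      = (\<Sum>\<zeta>\<in>?Z. ?B \<zeta> * (f (\<zeta> / z) - f z))
        - (\<Sum>\<zeta>\<in>?Z. ?A \<zeta> * (\<zeta> / z * ?f' (\<zeta> / z))) - (\<Sum>\<zeta>\<in>?Z. ?A \<zeta>) * (z * ?f' z)"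
    unfolding sum_distrib_left sum_distrib_right sum_subtractf[symmetric]
  proof (intro sum.cong refl)
    have "z * (b / z * x - a * (\<zeta> / z\<^sup>2 * p + q)) = b * x - a * (\<zeta> / z * p) - a * (z * q)"
      for a b x \<zeta> p q
      using z0 by (simp add: field_simps power2_eq_square)
    then show "z * (?B \<zeta> / z * (f (\<zeta> / z) - f z) - ?A \<zeta> * (\<zeta> / z\<^sup>2 * ?f' (\<zeta> / z) + ?f' z))
      = ?B \<zeta> * (f (\<zeta> / z) - f z) - ?A \<zeta> * (\<zeta> / z * ?f' (\<zeta> / z)) - ?A \<zeta> * (z * ?f' z)" for \<zeta> .
  qed
  have E: "(\<Sum>\<eta>\<in>?Z. ?A \<eta> * (L_op N \<alpha> f (\<eta> / z) - L_op N \<alpha> f z))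
      = (\<Sum>\<eta>\<in>?Z. ?A \<eta> * (\<eta> / z * ?f' (\<eta> / z))) - (\<Sum>\<eta>\<in>?Z. ?A \<eta>) * (z * ?f' z)
       + (\<Sum>\<eta>\<in>?Z. ?A \<eta> * ((\<Sum>\<zeta>\<in>?Z. dunkl_coeff c \<zeta> (\<eta> / z) * (f (\<zeta> / (\<eta> / z)) - f (\<eta> / z)))
          - (\<Sum>\<zeta>\<in>?Z. ?A \<zeta> * (f (\<zeta> / z) - f z))))"
    (is "?lhs = _ - _ + (\<Sum>\<eta>\<in>?Z. ?A \<eta> * (?P \<eta> - ?Q))")
  proof -
    have "?lhs = (\<Sum>\<eta>\<in>?Z. ?A \<eta> * (\<eta> / z * ?f' (\<eta> / z)) - ?A \<eta> * (z * ?f' z)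
        + ?A \<eta> * (?P \<eta> - ?Q))"
    proof (rule sum.cong)
      have "a * (p + x - (q + y)) = a * p - a * q + a * (x - y)" for a p x q y :: complex
        by (simp add: algebra_simps)
      then show "?A \<eta> * (L_op N \<alpha> f (\<eta> / z) - L_op N \<alpha> f z)
        = ?A \<eta> * (\<eta> / z * ?f' (\<eta> / z)) - ?A \<eta> * (z * ?f' z) + ?A \<eta> * (?P \<eta> - ?Q)" for \<eta>
        unfolding L[of f] .
    qed simp
    also have "\<dots> = (\<Sum>\<eta>\<in>?Z. ?A \<eta> * (\<eta> / z * ?f' (\<eta> / z))) - (\<Sum>\<eta>\<in>?Z. ?A \<eta> * (z * ?f' z))
        + (\<Sum>\<eta>\<in>?Z. ?A \<eta> * (?P \<eta> - ?Q))"
      by (simp only: sum.distrib[of "\<lambda>\<eta>. _ \<eta> - _ \<eta>"] sum_subtractf[of "\<lambda>\<eta>. ?A \<eta> * (\<eta> / z * _ \<eta>)"])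
    finally show ?thesis unfolding sum_distrib_right .
  qed
  show ?thesis
    unfolding L[of "L_op N \<alpha> f"] D Dsum E by simp
qed

text \<open>Stated for all symmetric functions holomorphic on the punctured plane. The first-order coefficient
  collects \<open>z\<close> from \<open>(z \<partial>\<^sub>z)\<^sup>2\<close>, \<open>-2zS\<close> from the cross terms, and \<open>-Nc z\<close> from \<open>-Nc L\<close>, with
  \<open>S = \<Sum>\<^sub>\<zeta> A\<^sub>\<zeta>\<close> in closed form by \<open>sum_dunkl_coeff\<close>.\<close>

lemma H_op_symmetric:
  fixes \<alpha> :: real
  defines "c \<equiv> of_real (2 * \<alpha> + 1) :: complex"
  assumes N: "N \<ge> 1" and z: "z \<in> generic_points N" and f: "f holomorphic_on - {0}"
    and sym: "\<And>w. w \<noteq> 0 \<Longrightarrow> f w = f (1 / w)"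
  shows "H_op N \<alpha> f z = z\<^sup>2 * deriv (deriv f) z + C_coeff N \<alpha> z * deriv f z
    + (\<Sum>\<zeta>\<in>unity_roots N. 2 * c * \<zeta> * z\<^sup>2 / (\<zeta> - z\<^sup>2)\<^sup>2 * (f (\<zeta> / z) - f z))"
proof -
  let ?Z = "unity_roots N"
  define F where "F = (\<lambda>\<zeta>. f (\<zeta> / z) - f z)"
  have z0: "z \<noteq> 0" using z by (rule generic_points_nonzero)
  have "f (\<zeta> / (\<eta> / z)) - f (\<eta> / z) = F (\<eta> / \<zeta>) - F \<eta>"
    if "\<zeta> \<in> ?Z" "\<eta> \<in> ?Z" for \<zeta> \<eta>
    using sym[of "\<zeta> / (\<eta> / z)"] unity_roots_nonzero[OF N] that z0 by (simp add: F_def mult.commute)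
  then have "L_op N \<alpha> (L_op N \<alpha> f) z = z * deriv f z + z\<^sup>2 * deriv (deriv f) z
    - 2 * (\<Sum>\<zeta>\<in>?Z. dunkl_coeff c \<zeta> z) * (z * deriv f z)
    + (\<Sum>\<zeta>\<in>?Z. 2 * c * \<zeta> * z\<^sup>2 / (\<zeta> - z\<^sup>2)\<^sup>2 * F \<zeta>)
    + (\<Sum>\<eta>\<in>?Z. dunkl_coeff c \<eta> z *
        ((\<Sum>\<zeta>\<in>?Z. dunkl_coeff c \<zeta> (\<eta> / z) * (F (\<eta> / \<zeta>) - F \<eta>))
          - (\<Sum>\<zeta>\<in>?Z. dunkl_coeff c \<zeta> z * F \<zeta>)))"
    unfolding L_op_L_op[OF N z f] c_def[symmetric] by (simp add: F_def)
  moreover have "F 1 = 0" using sym[OF z0] by (simp add: F_def)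
  ultimately have LL: "L_op N \<alpha> (L_op N \<alpha> f) z = z * deriv f z + z\<^sup>2 * deriv (deriv f) z
    - 2 * (\<Sum>\<zeta>\<in>?Z. dunkl_coeff c \<zeta> z) * (z * deriv f z)
    + (\<Sum>\<zeta>\<in>?Z. 2 * c * \<zeta> * z\<^sup>2 / (\<zeta> - z\<^sup>2)\<^sup>2 * F \<zeta>)
    + of_nat N * c * (\<Sum>\<zeta>\<in>?Z. dunkl_coeff c \<zeta> z * F \<zeta>)"
    using sum_dunkl_coeff_commutator[OF N z] by simp
  have L: "L_op N \<alpha> f z = z * deriv f z + (\<Sum>\<zeta>\<in>?Z. dunkl_coeff c \<zeta> z * F \<zeta>)"
    unfolding L_op_unity_roots[OF N] c_def F_def ..
  have C: "C_coeff N \<alpha> z = z * (1 - of_nat N * c - 2 * (\<Sum>\<zeta>\<in>?Z. dunkl_coeff c \<zeta> z))"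
  proof -
    have ne: "z ^ (2 * N) - 1 \<noteq> 0" "1 - z ^ (2 * N) \<noteq> 0"
      using z by (auto simp: generic_points_def)
    have "z ^ (2 * N) / (1 - z ^ (2 * N)) = - 1 - 1 / (z ^ (2 * N) - 1)"
      using ne by (simp add: divide_simps) (simp add: algebra_simps)
    then have "(\<Sum>\<zeta>\<in>?Z. dunkl_coeff c \<zeta> z) = c * of_nat N * (- 1 - 1 / (z ^ (2 * N) - 1))"
      unfolding sum_dunkl_coeff[OF N z] by (metis times_divide_eq_right)
    then show ?thesis
      unfolding C_coeff_def c_def[symmetric] \<open>sum _ _ = _\<close> by (simp add: algebra_simps)
  qed
  have Fz: "f (\<zeta> / z) - f z = F \<zeta>" for \<zeta> by (simp add: F_def)
  show ?thesis
    unfolding H_op_def LL L c_def[symmetric] C Fz by (simp add: algebra_simps)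
qed

lemma symmetric_laurent_polynomial_holomorphic:
  assumes "symmetric_laurent_polynomial f"
  shows "f holomorphic_on - {0}"
proof -
  obtain p m where "\<forall>z. z \<noteq> 0 \<longrightarrow> f z = poly p z / z ^ m"
    using assms unfolding symmetric_laurent_polynomial_def laurent_polynomial_def by blast
  moreover have "(\<lambda>z. poly p z / z ^ m) holomorphic_on - {0}"
    by (auto intro!: holomorphic_intros)
  ultimately show ?thesis by (subst holomorphic_cong[OF refl]) auto
qed

section \<open>The eigenvalue equation and the two forms of the operator\<close>

theorem proposition6:
  fixes N :: nat and \<alpha> :: real
  assumes "N \<ge> 1" and "\<alpha> > -1"
  shows
    "(\<forall>n. \<forall>z \<in> generic_points N.
        H_op N \<alpha> (\<lambda>w. poly (sieved_ultraspherical N \<alpha> n) (w + 1 / w)) z =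
          of_real (real n * (real n + (2 * \<alpha> + 1) * real N))
            * poly (sieved_ultraspherical N \<alpha> n) (z + 1 / z)) \<and>
     (\<forall>f. symmetric_laurent_polynomial f \<longrightarrow> (\<forall>z \<in> generic_points N.
        H_op N \<alpha> f z =
          z\<^sup>2 * deriv (deriv f) z + C_coeff N \<alpha> z * deriv f z
            + (\<Sum>k = 0..<N. B_coeff N \<alpha> k z * (R_op N k f z - f z)) \<and>
        H_op N \<alpha> f z =
          z\<^sup>2 * deriv (deriv f) z + C_coeff N \<alpha> z * deriv f z
            + (\<Sum>k = 1..<N. B_coeff N \<alpha> k z * (T_op N (- int k) f z - f z))))"
proof (intro conjI allI ballI impI)
  fix n :: nat and z assume z: "z \<in> generic_points N"
  show "H_op N \<alpha> (\<lambda>w. poly (sieved_ultraspherical N \<alpha> n) (w + 1 / w)) z =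
          of_real (real n * (real n + (2 * \<alpha> + 1) * real N))
            * poly (sieved_ultraspherical N \<alpha> n) (z + 1 / z)"
  proof (cases "n = 0")
    case True
    have "sieved_ultraspherical N \<alpha> 0 = 1"
      by (rule is_sieved_ultraspherical_unique[OF is_sieved_ultraspherical_sieved_ultraspherical])
         (simp add: is_sieved_ultraspherical_def)
    with True show ?thesis by (simp add: H_op_def L_op_def R_op_def)
  next
    case False
    \<comment> \<open>Division of \<open>n - 1\<close> rather than \<open>n\<close>: the remainder \<open>s\<close> must lie in \<open>1..N\<close>, not in \<open>0..N - 1\<close>.\<close>
    define j s where "j = (n - 1) div N" and "s = (n - 1) mod N + 1"
    have n: "n = N * j + s" using False by (simp add: j_def s_def)
    have s: "1 \<le> s" "s \<le> N"
      using assms(1) mod_less_divisor[of N "n - 1"] by (simp_all add: s_def Suc_le_eq)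
    \<comment> \<open>This is where \<open>\<alpha> > -1\<close> enters: no denominator of the recurrence vanishes.\<close>
    have c: "2 * of_nat (Suc i) + of_real (2 * \<alpha> + 1) \<noteq> (0 :: complex)" for i
    proof -
      have "2 * real (Suc i) + (2 * \<alpha> + 1) > 0" using assms(2) by simp
      then have "complex_of_real (2 * real (Suc i) + (2 * \<alpha> + 1)) \<noteq> 0"
        by (simp only: of_real_eq_0_iff)
      then show ?thesis by simp
    qed
    have "of_nat n * (of_nat n + of_nat N * of_real (2 * \<alpha> + 1))
        = complex_of_real (real n * (real n + (2 * \<alpha> + 1) * real N))"
      by (simp add: mult.commute)
    then show ?thesis
      using H_op_eigenfunction[OF assms(1) c s z, where j = j and
          f = "\<lambda>w. poly (sieved_ultraspherical N \<alpha> n) (w + 1 / w)"]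
        poly_sieved_ultraspherical[OF assms(1) s generic_points_nonzero, of _ N \<alpha> j]
      unfolding n[symmetric] by simp
  qed
next
  fix f z assume f: "symmetric_laurent_polynomial f" and z: "z \<in> generic_points N"
  have z0: "z \<noteq> 0" using z by (rule generic_points_nonzero)
  have sym: "f w = f (1 / w)" if "w \<noteq> 0" for w
    using f that unfolding symmetric_laurent_polynomial_def by blast
  have "H_op N \<alpha> f z = z\<^sup>2 * deriv (deriv f) z + C_coeff N \<alpha> z * deriv f z
    + (\<Sum>k<N. B_coeff N \<alpha> k z * (R_op N k f z - f z))"
    unfolding B_coeff_def R_op_def
      sum_q_root[OF assms(1), of "\<lambda>\<zeta>. 2 * of_real (2 * \<alpha> + 1) * \<zeta> * z\<^sup>2 / (\<zeta> - z\<^sup>2)\<^sup>2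
        * (f (\<zeta> / z) - f z)"]
    by (rule H_op_symmetric[OF assms(1) z symmetric_laurent_polynomial_holomorphic[OF f]])
       (rule sym)
  then show R: "H_op N \<alpha> f z = z\<^sup>2 * deriv (deriv f) z + C_coeff N \<alpha> z * deriv f z
    + (\<Sum>k = 0..<N. B_coeff N \<alpha> k z * (R_op N k f z - f z))"
    by (simp only: lessThan_atLeast0)
  have "R_op N k f z = T_op N (- int k) f z" for k
    using sym[of "q_root N ^ k / z"] z0
    by (simp add: R_op_def T_op_def q_root_def power_int_minus field_simps)
  moreover have "R_op N 0 f z = f z" using sym[OF z0] by (simp add: R_op_def)
  ultimately have "(\<Sum>k = 0..<N. B_coeff N \<alpha> k z * (R_op N k f z - f z))
      = (\<Sum>k = 1..<N. B_coeff N \<alpha> k z * (T_op N (- int k) f z - f z))"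
    using assms(1) by (simp add: sum.atLeast_Suc_lessThan[of 0 N])
  with R show "H_op N \<alpha> f z = z\<^sup>2 * deriv (deriv f) z + C_coeff N \<alpha> z * deriv f z
    + (\<Sum>k = 1..<N. B_coeff N \<alpha> k z * (T_op N (- int k) f z - f z))"
    by simp
qed

end
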